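(* Let $l$ be a fixed positive integer and let $\widetilde O_{k+1}=J(2k+1;k,k+1)$. Then, as $k\to\infty$ (with implied constants depending only on $l$): (i) For $l\ge 3$: $\mathrm{ex}(\widetilde O_{k+1},C_{4l})=O(k^{-\frac12+\frac1l})\,e(\widetilde O_{k+1})$. (ii) For $l\ge 3$: $\mathrm{ex}(\widetilde O_{k+1},C_{4l+2})=O(k^{-\frac{1}{2l+1}})\,e(\widetilde O_{k+1})$ if $l\in\{3,5,7,9\}$, and $\mathrm{ex}(\widetilde O_{k+1},C_{4l+2})=O(k^{-\frac1{16}+\frac{1}{8(l-1)}})\,e(\widetilde O_{k+1})$ otherwise. (iii) For every $k\ge1$, $\mathrm{ex}(\widetilde O_{k+1},C_6)\le \frac56 e(\widetilde O_{k+1})$; moreover $\mathrm{ex}(\widetilde O_{k+1},C_8)\le (\frac23+o(1))e(\widetilde O_{k+1})$ and $\mathrm{ex}(\widetilde O_{k+1},C_{10})\le(\frac23+o(1))e(\widetilde O_{k+1})$, where $o(1)\to0$ as $k\to\infty$.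
   Context: For positive integers $n\ge k+1$, the doubled Johnson graph $J(n;k,k+1)$ is the bipartite graph with vertex set $\binom{[n]}{k}\cup\binom{[n]}{k+1}$, where two vertices $u,v$ are adjacent iff $u\subset v$ or $v\subset u$. The doubled Odd graph is $\widetilde O_{k+1}=J(2k+1;k,k+1)$; it has $(k+1)\binom{2k+1}{k}$ edges. $C_m$ denotes the cycle of length $m$. $\mathrm{ex}(G,H)$ is the maximum number of edges of a subgraph of $G$ containing no subgraph isomorphic to $H$. *)

theory Defs
  imports Complex_Main "HOL-Library.Landau_Symbols"
begin

definition doubled_johnson_edges :: "nat \<Rightarrow> nat \<Rightarrow> (nat set \<times> nat set) set" where
  "doubled_johnson_edges n k =
     {(u, v). u \<subseteq> {..<n} \<and> card u = k \<and> v \<subseteq> {..<n} \<and> card v = k + 1 \<and> u \<subset> v}"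

definition doubled_odd_edges :: "nat \<Rightarrow> (nat set \<times> nat set) set" where
  "doubled_odd_edges k = doubled_johnson_edges (2 * k + 1) k"

definition adj :: "('a \<times> 'a) set \<Rightarrow> 'a \<Rightarrow> 'a \<Rightarrow> bool" where
  "adj F x y \<longleftrightarrow> (x, y) \<in> F \<or> (y, x) \<in> F"

text \<open>The graph with edge set F contains a (not necessarily induced) subgraph isomorphic
  to the cycle C_m (m \<ge> 3).\<close>
definition contains_cycle :: "('a \<times> 'a) set \<Rightarrow> nat \<Rightarrow> bool" where
  "contains_cycle F m \<longleftrightarrow>
     (\<exists>f :: nat \<Rightarrow> 'a. inj_on f {..<m} \<and> (\<forall>i<m. adj F (f i) (f (Suc i mod m))))"

definition ex_cycle :: "('a \<times> 'a) set \<Rightarrow> nat \<Rightarrow> nat" where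
  "ex_cycle E m = Max (card ` {F. F \<subseteq> E \<and> \<not> contains_cycle F m})"

end

theory Submission
  imports Defs
begin

text \<open>
  Let F be a subgraph of the doubled Odd graph. Call an r-set T full over a set w of size k + 1 - r,
  disjoint from T, if F contains the r edges between w \<union> T and the sets w \<union> T - {x}, x \<in> T. If F
  has many edges, convexity of binomial coefficients gives a w with many full r-sets.

  A 2l-cycle in the graph of full pairs over w is a 4l-cycle in F, so the Bondy--Simonovits theorem
  bounds F; already l = 2 gives the relative density O(k^(-1/4)) for the 8-cycle.

  For length 4l + 2 take full triples abc over w. A cycle in the link of a through the edge bc
  gives a cycle in F through the edge from w \<union> ab to w \<union> abc, and so does a cycle in the link
  of b through ac. Gluing a 4-cycle of the first kind with a (2l - 2)-cycle of the second kind and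
  dropping the common edge yields a cycle of length 8 + 4(l - 1) - 2. Only O(k^(5/2)) triples fail
  to admit such cycles, which gives the relative density O(k^(-1/6)) for every l \<ge> 3, better than
  what is claimed.

  The graph is covered uniformly by hexagons. A graph without 6-cycles misses an edge of
  each of them. Two hexagons that share only an edge e form a 10-cycle after deletion of e; hence in a
  graph without 10-cycles almost all hexagons have at least two missing edges.
\<close>

section \<open>The Bondy--Simonovits theorem\<close>

text \<open>Full pairs alone cannot handle length 4l + 2: this would require a cycle of odd length
  2l + 1 in the graph of pairs, and excluding an odd cycle still allows quadratically many edges.
  Triples help because one triple is an edge in the link of each of its elements: an even cycle over
  w + a and one over w + b both turn into cycles of F of length divisible by 4, and dropping a
  common edge takes 2 off the sum. All exponents come from one balance: if every w has at most of
  order t^r full r-sets, then the relative density is of order t / k. For pairs t^2 = k^(1 + 1/l),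
  which gives -1/2 + 1/(2l). For triples each of the 2k + 1 links has O(k^(3/2)) bad edges, so t^3 =
  k^(5/2) and the exponent is -1/6; the 4-cycle dominates this cost, since the other cycle has
  length at least 4. For l = 2 that second cycle would have length 2, so length 10 needs the
  separate argument with hexagons.\<close>

lemma contains_cycleI:
  assumes "distinct xs" "successively (adj F) xs" "xs \<noteq> []" "adj F (last xs) (hd xs)"
  shows "contains_cycle F (length xs)"
  unfolding contains_cycle_def
proof (intro exI[of _ "\<lambda>i. xs ! i"] conjI allI impI)
  show "inj_on ((!) xs) {..<length xs}"
    using assms(1) by (auto simp: inj_on_def nth_eq_iff_index_eq)
next
  fix i assume i: "i < length xs"
  show "adj F (xs ! i) (xs ! (Suc i mod length xs))"
  proof (cases "Suc i < length xs")
    case True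
    then show ?thesis using assms(2) by (simp add: successively_conv_nth)
  next
    case False
    then have "i = length xs - 1" "Suc i = length xs" using i by auto
    then have "xs ! i = last xs" "Suc i mod length xs = 0"
      using assms(3) by (auto simp: last_conv_nth)
    then show ?thesis using assms(3,4) by (simp add: hd_conv_nth)
  qed
qed

lemma contains_cycle_mono:
  "contains_cycle F n \<Longrightarrow> F \<subseteq> G \<Longrightarrow> contains_cycle G n"
  unfolding contains_cycle_def adj_def by blast

lemma adj_sym_rel: "sym R \<Longrightarrow> adj R x y \<longleftrightarrow> (x, y) \<in> R"
  by (auto simp: adj_def dest: symD)

text \<open>A vertex of degree at most \<open>d\<close> accounts for at most \<open>2 * d\<close>
  ordered pairs of the symmetric relation, so its deletion preserves the strict inequality;
  strictness keeps the remaining graph nonempty.\<close>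

lemma min_degree_subgraph:
  fixes R :: "('a \<times> 'a) set"
  assumes "finite R" "sym R" "2 * d * card (Field R) < card R"
  shows "\<exists>R'\<subseteq>R. sym R' \<and> R' \<noteq> {} \<and> (\<forall>v\<in>Field R'. d < card (R' `` {v}))"
  using assms
proof (induction "card (Field R)" arbitrary: R rule: less_induct)
  case less
  show ?case
  proof (cases "\<forall>v\<in>Field R. d < card (R `` {v})")
    case True
    then show ?thesis using less.prems by (intro exI[of _ R]) auto
  next
    case False
    then obtain v where v: "v \<in> Field R" "card (R `` {v}) \<le> d" by (meson not_le)
    define R1 where "R1 = {p \<in> R. fst p \<noteq> v \<and> snd p \<noteq> v}"
    have fin: "finite R1" "finite (R `` {v})" "finite (Field R)"
      using less.prems(1) by (auto simp: R1_def finite_Field)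
    have "R \<subseteq> R1 \<union> (Pair v ` (R `` {v}) \<union> (\<lambda>y. (y, v)) ` (R `` {v}))"
      using less.prems(2) by (auto simp: R1_def image_iff dest: symD)
    then have "card R \<le> card (R1 \<union> (Pair v ` (R `` {v}) \<union> (\<lambda>y. (y, v)) ` (R `` {v})))"
      using fin by (intro card_mono) auto
    also have "\<dots> \<le> card R1 + (card (Pair v ` (R `` {v})) + card ((\<lambda>y. (y, v)) ` (R `` {v})))"
      by (meson card_Un_le add_left_mono le_trans)
    also have "\<dots> \<le> card R1 + 2 * d"
      using v(2) fin(2) card_image_le[of "R `` {v}" "Pair v"] card_image_le[of "R `` {v}" "\<lambda>y. (y, v)"]
      by linarith
    finally have c: "card R \<le> card R1 + 2 * d" .
    have "Field R1 \<subseteq> Field R - {v}" by (auto simp: R1_def Field_def)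
    then have "card (Field R1) \<le> card (Field R - {v})" using fin by (intro card_mono) auto
    then have f: "Suc (card (Field R1)) \<le> card (Field R)"
      using v(1) fin(3) by (metis card_Suc_Diff1 Suc_le_mono)
    have "2 * d * Suc (card (Field R1)) \<le> 2 * d * card (Field R)" using f by (rule mult_le_mono2)
    then have "2 * d * card (Field R1) < card R1" using c less.prems(3) by simp
    moreover have "sym R1" using less.prems(2) by (auto simp: R1_def sym_def)
    ultimately obtain R' where "R' \<subseteq> R1" "sym R' \<and> R' \<noteq> {} \<and> (\<forall>v\<in>Field R'. d < card (R' `` {v}))"
      using less.hyps[of R1] f fin(1) by auto
    then show ?thesis unfolding R1_def by blast
  qed
qed

text \<open>Greedy extension: each vertex used is added to the forbidden set \<open>Z\<close>, which
  by \<open>card Z + t \<le> D\<close> never covers a whole neighbourhood.\<close>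

lemma path_avoiding:
  assumes deg: "\<And>v. v \<in> Field F \<Longrightarrow> D < card (F `` {v})"
    and "y \<in> Field F" "finite Z" "y \<notin> Z" "card Z + t \<le> D"
  shows "\<exists>xs. length xs = Suc t \<and> hd xs = y \<and> distinct xs \<and> set xs \<inter> Z = {} \<and>
            set xs \<subseteq> Field F \<and> successively (\<lambda>x y. (x, y) \<in> F) xs"
  using assms(2-)
proof (induction t arbitrary: y Z)
  case 0
  then show ?case by (intro exI[of _ "[y]"]) auto
next
  case (Suc t)
  have "card (insert y Z) < card (F `` {y})"
    using Suc.prems deg[of y] by simp
  then have "\<not> F `` {y} \<subseteq> insert y Z"
    using Suc.prems(2) by (meson card_mono finite.insertI not_le)
  then obtain y1 where y1: "(y, y1) \<in> F" "y1 \<notin> insert y Z" by auto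
  then obtain xs where xs: "length xs = Suc t" "hd xs = y1" "distinct xs" "set xs \<inter> insert y Z = {}"
    "set xs \<subseteq> Field F" "successively (\<lambda>x y. (x, y) \<in> F) xs"
    using Suc.IH[of y1 "insert y Z"] Suc.prems by (auto simp: Field_def)
  then show ?case using y1 Suc.prems
    by (intro exI[of _ "y # xs"]) (auto simp: successively_Cons)
qed

text \<open>Vertices are inserted one by one, each on the side that separates it from at least half
  of its earlier neighbours.\<close>

lemma bipartite_subgraph:
  fixes R :: "('a \<times> 'a) set"
  assumes "finite V" "R \<subseteq> V \<times> V" "sym R" "irrefl R"
  shows "\<exists>S. card R \<le> 2 * card {(x, y) \<in> R. (x \<in> S) \<noteq> (y \<in> S)}"
  using assms
proof (induction V arbitrary: R rule: finite_induct)
  case empty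
  then show ?case by auto
next
  case (insert v V)
  define R' where "R' = R \<inter> V \<times> V"
  define N where "N = R `` {v}"
  have N: "N \<subseteq> V" "v \<notin> N"
    using insert.prems by (auto simp: N_def irrefl_def)
  have fN: "finite N" using N(1) insert.hyps(1) finite_subset by blast
  have finR: "finite R" using insert.prems(1) insert.hyps(1)
    by (meson finite.insertI finite_SigmaI finite_subset)
  have "sym R'" "irrefl R'" using insert.prems by (auto simp: R'_def sym_def irrefl_def)
  then obtain S where S: "card R' \<le> 2 * card {(x, y) \<in> R'. (x \<in> S) \<noteq> (y \<in> S)}"
    using insert.IH[of R'] by (auto simp: R'_def)
  have Req: "R = R' \<union> ({v} \<times> N \<union> N \<times> {v})"
    using insert.prems insert.hyps by (auto simp: R'_def N_def irrefl_def dest: symD)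
  have "card R \<le> card R' + (card ({v} \<times> N) + card (N \<times> {v}))"
    unfolding Req by (meson card_Un_le add_left_mono le_trans)
  then have cR: "card R \<le> card R' + 2 * card N" by (simp add: card_cartesian_product)
  \<comment> \<open>\<open>S'\<close> differs from \<open>S\<close> at most in \<open>v\<close>, and
    \<open>M\<close> consists of neighbours of \<open>v\<close> that end up on the other
    side.\<close>
  have key: "card R \<le> 2 * card {(x, y) \<in> R. (x \<in> S') \<noteq> (y \<in> S')}"
    if S': "S' - {v} = S - {v}" and M: "M \<subseteq> N" "\<And>y. y \<in> M \<Longrightarrow> (v \<in> S') \<noteq> (y \<in> S')"
      "card N \<le> 2 * card M" for S' M
  proof -
    let ?C = "{(x, y) \<in> R'. (x \<in> S) \<noteq> (y \<in> S)}"
    have fM: "finite M" using M(1) fN finite_subset by blast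
    have fC: "finite ?C" using finR by (rule finite_subset[rotated]) (auto simp: R'_def)
    have eqS: "x \<in> S \<longleftrightarrow> x \<in> S'" if "x \<in> V" for x
      using that S' insert.hyps(2) by (cases "x = v") auto
    have sub: "?C \<union> ({v} \<times> M \<union> M \<times> {v}) \<subseteq> {(x, y) \<in> R. (x \<in> S') \<noteq> (y \<in> S')}"
      using M eqS by (auto simp: Req) (auto simp: R'_def)
    have "card (?C \<union> ({v} \<times> M \<union> M \<times> {v})) = card ?C + card ({v} \<times> M \<union> M \<times> {v})"
      using insert.hyps fM fC by (intro card_Un_disjoint) (auto simp: R'_def)
    also have "card ({v} \<times> M \<union> M \<times> {v}) = card ({v} \<times> M) + card (M \<times> {v})"
      using N M fM by (intro card_Un_disjoint) auto
    finally have "card ?C + 2 * card M = card (?C \<union> ({v} \<times> M \<union> M \<times> {v}))"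
      by (simp add: card_cartesian_product)
    also have "\<dots> \<le> card {(x, y) \<in> R. (x \<in> S') \<noteq> (y \<in> S')}"
      using sub by (rule card_mono[rotated]) (rule finite_subset[OF _ finR], auto)
    finally show ?thesis using S cR M(3) by linarith
  qed
  have "card N = card (N \<inter> S) + card (N - S)"
    using fN by (metis card_Int_Diff)
  then consider "card N \<le> 2 * card (N \<inter> S)" | "card N \<le> 2 * card (N - S)" by linarith
  then show ?case
  proof cases
    case 1
    show ?thesis by (rule exI[of _ "S - {v}"], rule key[of _ "N \<inter> S"]) (use 1 N in auto)
  next
    case 2
    show ?thesis by (rule exI[of _ "insert v S"], rule key[of _ "N - S"]) (use 2 N in auto)
  qed
qed

section \<open>Cycles from the levels of a search tree\<close>

lemma successively_invariant:
  assumes "successively (\<lambda>x y. (x, y) \<in> F) xs" "\<And>x y. (x, y) \<in> F \<Longrightarrow> \<phi> x = \<phi> y" "x \<in> set xs"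
  shows "\<phi> x = \<phi> (hd xs)"
  using assms(1,3)
proof (induction xs rule: induct_list012)
  case (3 a b xs)
  then show ?case using assms(2)[of a b] by auto
qed auto

text \<open>
  Choose t maximal such that some vertex z of level i + 1 has two neighbours in F with different
  t-th ancestors; then the (t+1)-st ancestors agree along paths of F. A path in F that enters z
  through a third neighbour can be continued to either of the two, and for one choice its ends have different t-th
  ancestors. The tree then closes it to a cycle of prescribed length.
\<close>

lemma cycle_from_dense_levels:
  fixes R :: "('a \<times> 'a) set" and \<delta> :: "'a \<Rightarrow> nat"
  assumes "sym R"
    and parent: "\<And>x i. x \<in> W \<Longrightarrow> \<delta> x = Suc i \<Longrightarrow> p x \<in> W \<and> (p x, x) \<in> R \<and> \<delta> (p x) = i"
    and root: "\<And>x y. x \<in> W \<Longrightarrow> y \<in> W \<Longrightarrow> \<delta> x = 0 \<Longrightarrow> \<delta> y = 0 \<Longrightarrow> x = y"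
    and "F \<subseteq> R" "sym F" "F \<noteq> {}"
    and FW: "\<And>x y. (x, y) \<in> F \<Longrightarrow>
               x \<in> W \<and> (\<delta> x = i \<and> \<delta> y = Suc i \<or> \<delta> x = Suc i \<and> \<delta> y = i)"
    and deg: "\<And>v. v \<in> Field F \<Longrightarrow> 2 * m + 3 < card (F `` {v})"
    and "i < m"
  shows "contains_cycle R (2 * m)"
proof -
  have lev: "(p ^^ t) y \<in> W \<and> \<delta> ((p ^^ t) y) = i - t" if "y \<in> W" "\<delta> y = i" "t \<le> i" for t y
    using that(3)
  proof (induction t)
    case (Suc t)
    then have "(p ^^ t) y \<in> W" "\<delta> ((p ^^ t) y) = Suc (i - Suc t)" by auto
    then show ?case using parent by simp
  qed (use that in auto)
  have up: "((p ^^ Suc t) y, (p ^^ t) y) \<in> R" if "y \<in> W" "\<delta> y = i" "t < i" for t y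
  proof -
    have "(p ^^ t) y \<in> W" "\<delta> ((p ^^ t) y) = Suc (i - Suc t)"
      using lev[of y t] that by auto
    then show ?thesis using parent by simp
  qed
  define Q where "Q t \<longleftrightarrow> (\<exists>z y y'. \<delta> z = Suc i \<and> (z, y) \<in> F \<and> (z, y') \<in> F \<and>
    (p ^^ t) y \<noteq> (p ^^ t) y')" for t
  have FY: "y \<in> W \<and> \<delta> y = i" if "(z, y) \<in> F" "\<delta> z = Suc i" for z y
    using FW[OF that(1)] FW[of y z] that \<open>sym F\<close> by (auto dest: symD)
  have big: "\<exists>y\<in>F `` {v}. y \<notin> Z" if "v \<in> Field F" "finite Z" "card Z \<le> 3" for v Z
  proof (rule ccontr)
    assume "\<not> ?thesis"
    then have "F `` {v} \<subseteq> Z" by auto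
    then have "card (F `` {v}) \<le> 3" using that by (meson card_mono le_trans)
    then show False using deg[OF that(1)] by simp
  qed
  obtain z0 where z0: "z0 \<in> Field F" "\<delta> z0 = Suc i"
  proof -
    obtain a b where "(a, b) \<in> F" using \<open>F \<noteq> {}\<close> by auto
    then have "a \<in> Field F" "b \<in> Field F" "\<delta> a = Suc i \<or> \<delta> b = Suc i"
      using FW[of a b] by (auto simp: Field_def)
    then show thesis using that by blast
  qed
  obtain y where y: "y \<in> F `` {z0}" using big[OF z0(1), of "{}"] by auto
  obtain y' where "y' \<in> F `` {z0}" "y' \<noteq> y" using big[OF z0(1), of "{y}"] by auto
  then have "Q 0" using y z0 by (auto simp: Q_def)
  moreover have "\<not> Q i"
  proof
    assume "Q i"
    then obtain z y y' where "\<delta> z = Suc i" "(z, y) \<in> F" "(z, y') \<in> F" "(p ^^ i) y \<noteq> (p ^^ i) y'"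
      by (auto simp: Q_def)
    then show False using root[of "(p ^^ i) y" "(p ^^ i) y'"] lev[of y i] lev[of y' i] FY by auto
  qed
  ultimately obtain t where t: "t < i" "Q t" "\<not> Q (Suc t)"
    using ex_least_nat_less[of "\<lambda>t. \<not> Q t" i] by auto
  define h where "h = Suc t"
  \<comment> \<open>The cycle will consist of two tree paths with \<open>h\<close> edges each, two
    edges at \<open>z\<close> and a path of \<open>F\<close> with \<open>2 * (s - 1)\<close> edges:
    \<open>2 * (h + s) = 2 * m\<close> in total.\<close>
  define s where "s = m - h"
  have hs: "h \<le> i" "1 \<le> s" "h + s = m" using t(1) \<open>i < m\<close> by (auto simp: h_def s_def)
  obtain z y1 y2 where z: "\<delta> z = Suc i" "(z, y1) \<in> F" "(z, y2) \<in> F" "(p ^^ t) y1 \<noteq> (p ^^ t) y2"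
    using t(2) by (auto simp: Q_def)
  have zF: "z \<in> Field F" using z(2) by (auto simp: Field_def)
  have "card {z, y1, y2} \<le> 3" by (simp add: card_insert_if)
  then obtain y0 where y0: "(z, y0) \<in> F" "y0 \<notin> {z, y1, y2}"
    using big[OF zF, of "{z, y1, y2}"] by auto
  \<comment> \<open>The 3 in the degree bound pays for these three vertices, the
    \<open>2 * m\<close> for the path.\<close>
  have cZ: "card {z, y1, y2} + 2 * (s - 1) \<le> 2 * m + 3"
    using \<open>card {z, y1, y2} \<le> 3\<close> hs by linarith
  obtain xs where xs: "length xs = Suc (2 * (s - 1))" "hd xs = y0" "distinct xs"
    "set xs \<inter> {z, y1, y2} = {}" "set xs \<subseteq> Field F" "successively (\<lambda>x y. (x, y) \<in> F) xs"
    using path_avoiding[of F "2 * m + 3" y0 "{z, y1, y2}" "2 * (s - 1)"] deg y0 cZ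
    by (auto simp: Field_def)
  have xs_ne: "xs \<noteq> []" using xs(1) by auto
  have FxW: "x \<in> W" "\<delta> x = i \<or> \<delta> x = Suc i" if xF: "x \<in> Field F" for x
  proof -
    obtain y where "(x, y) \<in> F" using xF symD[OF \<open>sym F\<close>] unfolding Field_def by blast
    then show "x \<in> W" "\<delta> x = i \<or> \<delta> x = Suc i" using FW by blast+
  qed
  have par: "\<delta> (xs ! j) = (if even j then i else Suc i)" if "j < length xs" for j
    using that
  proof (induction j)
    case 0
    then show ?case using xs(2) FY[OF y0(1) z(1)] by (simp add: hd_conv_nth xs_ne)
  next
    case (Suc j)
    then have "(xs ! j, xs ! Suc j) \<in> F" using xs(6) by (simp add: successively_conv_nth)
    then show ?case using FW[of "xs ! j" "xs ! Suc j"] Suc by (auto split: if_splits)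
  qed
  define r where "r = last xs"
  have rs: "r \<in> set xs" using xs_ne by (simp add: r_def)
  then have "r \<in> W" using xs(5) FxW(1) by blast
  moreover have "\<delta> r = i" using par[of "length xs - 1"] xs(1) xs_ne by (simp add: r_def last_conv_nth)
  ultimately have r: "r \<in> set xs" "\<delta> r = i" "r \<in> W" using rs by auto
  \<comment> \<open>\<open>\<phi>\<close> extends the \<open>h\<close>-th ancestor to the upper
    level through an arbitrary neighbour in \<open>F\<close>; the failure of
    \<open>Q (Suc t)\<close> makes the choice immaterial, so \<open>\<phi>\<close> is constant along
    paths of \<open>F\<close>.\<close>
  define \<phi> where "\<phi> x = (p ^^ h) (if \<delta> x = i then x else (SOME y. (x, y) \<in> F))" for x
  have const: "(p ^^ h) y = (p ^^ h) y'" if "(z, y) \<in> F" "(z, y') \<in> F" "\<delta> z = Suc i" for z y y'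
    using t(3) that unfolding Q_def h_def by blast
  have \<phi>2: "\<phi> z = \<phi> y" if "(z, y) \<in> F" "\<delta> z = Suc i" for z y
    using const[OF that(1) someI[of "\<lambda>y. (z, y) \<in> F", OF that(1)] that(2)] FY[OF that] that(2)
    by (simp add: \<phi>_def)
  have "\<phi> x = \<phi> y" if "(x, y) \<in> F" for x y
    using FW[OF that] \<phi>2[of x y] \<phi>2[of y x] that \<open>sym F\<close> by (auto dest: symD)
  then have "\<phi> r = \<phi> y0" using successively_invariant[of F xs \<phi> r] xs r by auto
  then have top: "(p ^^ h) r = (p ^^ h) y0" using r FY[OF y0(1) z(1)] by (simp add: \<phi>_def)
  have "\<exists>y\<in>{y1, y2}. (p ^^ t) y \<noteq> (p ^^ t) r" using z(4) by auto
  then obtain y where y: "y \<in> {y1, y2}" "(p ^^ t) y \<noteq> (p ^^ t) r" by blast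
  have yF: "(z, y) \<in> F" using y z by auto
  have yW: "y \<in> W" "\<delta> y = i" using FY[OF yF z(1)] by auto
  have top': "(p ^^ h) r = (p ^^ h) y" using top const[OF yF y0(1) z(1)] by simp
  \<comment> \<open>Tree paths stay together once they meet, so different \<open>t\<close>-th
    ancestors keep them apart below the common \<open>h\<close>-th ancestor.\<close>
  have neq: "(p ^^ a) y \<noteq> (p ^^ a) r" if "a < h" for a
  proof
    assume "(p ^^ a) y = (p ^^ a) r"
    then have "(p ^^ (t - a)) ((p ^^ a) y) = (p ^^ (t - a)) ((p ^^ a) r)" by simp
    then have "(p ^^ t) y = (p ^^ t) r"
      using that funpow_add[of "t - a" a p] by (simp add: h_def)
    then show False using y by simp
  qed
  define ds where "ds = map (\<lambda>a. (p ^^ a) y) [0..<h]"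
  define us where "us = map (\<lambda>a. (p ^^ a) r) [1..<Suc h]"
  define cs where "cs = rev ds @ z # xs @ us"
  have ds_mem: "\<exists>a<h. u = (p ^^ a) y" if "u \<in> set ds" for u
    using that by (auto simp: ds_def)
  have us_mem: "\<exists>a. 1 \<le> a \<and> a \<le> h \<and> u = (p ^^ a) r" if "u \<in> set us" for u
    using that unfolding us_def set_map set_upt by (auto simp del: upt_Suc)
  have dl: "\<delta> ((p ^^ a) y) = i - a" "\<delta> ((p ^^ a) r) = i - a" if "a \<le> h" for a
    using lev[of y a] lev[of r a] yW r that hs by auto
  have inj: "a = b" if "\<delta> ((p ^^ a) u) = i - a" "\<delta> ((p ^^ b) u) = i - b"
      "(p ^^ a) u = (p ^^ b) u" "a \<le> h" "b \<le> h" for a b u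
  proof -
    have "i - a = i - b" using that by metis
    then show ?thesis using that hs by linarith
  qed
  have "distinct ds" unfolding ds_def distinct_map
    by (intro conjI distinct_upt inj_onI, rule inj[OF dl(1) dl(1)]) (simp_all add: dl)
  moreover have "distinct us" unfolding us_def distinct_map
    by (intro conjI distinct_upt inj_onI, rule inj[OF dl(2) dl(2)]) (simp_all add: dl del: upt_Suc)
  moreover have "set ds \<inter> insert z (set xs) = {}"
  proof -
    have "(p ^^ a) y \<noteq> z" if "a < h" for a using dl[of a] z(1) that by auto
    moreover have "(p ^^ a) y \<notin> set xs" if "a < h" for a
    proof (cases a)
      case 0
      then show ?thesis using xs(4) y by auto
    next
      case (Suc b)
      then have "\<delta> ((p ^^ a) y) < i" using dl[of a] that hs by auto
      then show ?thesis using xs(5) FxW by force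
    qed
    ultimately have "\<And>a. a < h \<Longrightarrow> (p ^^ a) y \<notin> insert z (set xs)" by simp
    then show ?thesis using ds_mem by blast
  qed
  moreover have "set us \<inter> insert z (set xs) = {}"
  proof -
    have "(p ^^ a) r \<notin> insert z (set xs)" if "1 \<le> a" "a \<le> h" for a
    proof -
      have "\<delta> ((p ^^ a) r) < i" using dl[of a] that hs by auto
      then show ?thesis using xs(5) FxW z(1) by force
    qed
    then show ?thesis using us_mem by blast
  qed
  moreover have "set ds \<inter> set us = {}"
  proof -
    have "(p ^^ a) y \<noteq> (p ^^ b) r" if "a < h" "b \<le> h" for a b
    proof
      assume e: "(p ^^ a) y = (p ^^ b) r"
      then have "i - a = i - b" using dl that by (metis less_imp_le_nat)
      then have "a = b" using that hs by auto
      then show False using e neq that by auto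
    qed
    then show ?thesis using ds_mem us_mem by blast
  qed
  ultimately have "distinct cs" using xs(3,4) by (auto simp: cs_def)
  moreover have "successively (adj R) cs"
  proof -
    have 1: "successively (adj R) (rev ds)"
      unfolding successively_rev
      using up[OF yW] hs by (auto simp: ds_def successively_conv_nth adj_def)
    have 2: "successively (adj R) us"
      using up[OF r(3,2), of "Suc a" for a] hs by (auto simp: us_def successively_conv_nth adj_def simp del: upt_Suc)
    have 3: "successively (adj R) xs"
      using xs(6) by (rule successively_mono) (use \<open>F \<subseteq> R\<close> in \<open>auto simp: adj_def\<close>)
    have 4: "last (rev ds) = y" "rev ds \<noteq> []"
      by (auto simp: ds_def h_def last_rev hd_map simp del: upt_Suc)
    have 5: "us \<noteq> []" "hd us = p r" by (auto simp: us_def h_def hd_map simp del: upt_Suc)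
    have 6: "adj R y z" "adj R z y0" using yF y0 \<open>F \<subseteq> R\<close> by (auto simp: adj_def)
    have 7: "adj R r (p r)" using up[of r 0] r hs t by (auto simp: adj_def)
    show ?thesis unfolding cs_def successively_append_iff successively_Cons
      using 1 2 3 4 5 6 7 xs xs_ne by (auto simp: r_def)
  qed
  moreover have "adj R (last cs) (hd cs)"
  proof -
    have "last cs = (p ^^ h) r" by (simp add: cs_def us_def h_def)
    moreover have "hd cs = (p ^^ t) y" by (simp add: cs_def ds_def h_def)
    ultimately show ?thesis using up[OF yW t(1)] top' by (auto simp: adj_def h_def)
  qed
  moreover have "length cs = h + Suc (length xs + h)" by (simp add: cs_def ds_def us_def del: upt_Suc)
  then have "length cs = 2 * m" using xs(1) hs by linarith
  moreover have "cs \<noteq> []" by (simp add: cs_def)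
  ultimately show ?thesis using contains_cycleI[of cs R] by simp
qed

text \<open>Breadth-first search from \<open>r\<close>: \<open>\<delta>\<close> is the distance,
  \<open>W\<close> the component, and \<open>p\<close> picks a predecessor on a shortest walk. The
  bipartition fixes the parity of walk lengths and thereby excludes edges inside a level.\<close>

lemma distance_levels:
  fixes R :: "('a \<times> 'a) set"
  assumes "sym R" and bip: "\<And>x y. (x, y) \<in> R \<Longrightarrow> (x \<in> S) \<noteq> (y \<in> S)"
  obtains W \<delta> p where
    "r \<in> W" "\<delta> r = (0::nat)"
    "\<And>x y. x \<in> W \<Longrightarrow> y \<in> W \<Longrightarrow> \<delta> x = 0 \<Longrightarrow> \<delta> y = 0 \<Longrightarrow> x = y"
    "\<And>x y. x \<in> W \<Longrightarrow> (x, y) \<in> R \<Longrightarrow> y \<in> W \<and> (\<delta> y = Suc (\<delta> x) \<or> \<delta> x = Suc (\<delta> y))"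
    "\<And>x i. x \<in> W \<Longrightarrow> \<delta> x = Suc i \<Longrightarrow> p x \<in> W \<and> (p x, x) \<in> R \<and> \<delta> (p x) = i"
    "W \<subseteq> insert r (Field R)"
proof -
  define W where "W = {x. \<exists>i. (r, x) \<in> R ^^ i}"
  define \<delta> where "\<delta> x = (LEAST i. (r, x) \<in> R ^^ i)" for x
  have reach: "(r, x) \<in> R ^^ \<delta> x" if "x \<in> W" for x
    using that unfolding \<delta>_def W_def by (auto intro: LeastI)
  have least: "\<delta> x \<le> i" if "(r, x) \<in> R ^^ i" for x i
    unfolding \<delta>_def using that by (rule Least_le)
  have parity: "(x \<in> S) \<longleftrightarrow> (r \<in> S) = even i" if "(r, x) \<in> R ^^ i" for x i
    using that
  proof (induction i arbitrary: x)
    case (Suc i)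
    then obtain y where "(r, y) \<in> R ^^ i" "(y, x) \<in> R" by auto
    then show ?case using Suc.IH[of y] bip[of y x] by auto
  qed auto
  have step: "y \<in> W \<and> \<delta> y \<le> Suc (\<delta> x)" if "x \<in> W" "(x, y) \<in> R" for x y
  proof -
    have "(r, y) \<in> R ^^ Suc (\<delta> x)" using reach[OF that(1)] that(2) by auto
    then show ?thesis using least W_def by blast
  qed
  have edge: "y \<in> W \<and> (\<delta> y = Suc (\<delta> x) \<or> \<delta> x = Suc (\<delta> y))" if "x \<in> W" "(x, y) \<in> R" for x y
  proof -
    have "y \<in> W" "\<delta> y \<le> Suc (\<delta> x)" using step that by auto
    moreover have "\<delta> x \<le> Suc (\<delta> y)"
      using step[OF \<open>y \<in> W\<close>, of x] that(2) \<open>sym R\<close> by (auto dest: symD)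
    moreover have "\<delta> x \<noteq> \<delta> y"
      using parity[OF reach[OF that(1)]] parity[OF reach[OF \<open>y \<in> W\<close>]] bip[OF that(2)] by auto
    ultimately show ?thesis by auto
  qed
  have "\<exists>y. y \<in> W \<and> (y, x) \<in> R \<and> \<delta> y = i" if "x \<in> W" "\<delta> x = Suc i" for x i
  proof -
    have "(r, x) \<in> R ^^ Suc i" using reach[OF that(1)] that(2) by simp
    then obtain y where y: "(r, y) \<in> R ^^ i" "(y, x) \<in> R" by auto
    have "y \<in> W" using y W_def by auto
    moreover have "\<delta> y = i" using step[OF \<open>y \<in> W\<close> y(2)] least[OF y(1)] that(2) by auto
    ultimately show ?thesis using y by auto
  qed
  then have ex: "\<exists>y. y \<in> W \<and> (y, x) \<in> R \<and> \<delta> x = Suc (\<delta> y)" if "x \<in> W" "\<delta> x = Suc i" for x i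
    using that by metis
  define p where "p x = (SOME y. y \<in> W \<and> (y, x) \<in> R \<and> \<delta> x = Suc (\<delta> y))" for x
  have par: "p x \<in> W \<and> (p x, x) \<in> R \<and> \<delta> (p x) = i" if "x \<in> W" "\<delta> x = Suc i" for x i
    using someI_ex[OF ex[OF that]] that(2) unfolding p_def[symmetric] by auto
  have W0: "x = r" if "x \<in> W" "\<delta> x = 0" for x using reach[OF that(1)] that(2) by simp
  have "\<exists>i. (r, r) \<in> R ^^ i" by (rule exI[of _ 0]) simp
  then have "r \<in> W" by (simp add: W_def)
  show thesis
  proof (rule that)
    show "r \<in> W" "\<delta> r = 0" using \<open>r \<in> W\<close> least[of r 0] by auto
    show "x = y" if "x \<in> W" "y \<in> W" "\<delta> x = 0" "\<delta> y = 0" for x y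
      using W0[of x] W0[of y] that by simp
    show "y \<in> W \<and> (\<delta> y = Suc (\<delta> x) \<or> \<delta> x = Suc (\<delta> y))" if "x \<in> W" "(x, y) \<in> R" for x y
      using that by (rule edge)
    show "p x \<in> W \<and> (p x, x) \<in> R \<and> \<delta> (p x) = i" if "x \<in> W" "\<delta> x = Suc i" for x i
      using that by (rule par)
    show "W \<subseteq> insert r (Field R)"
    proof
      fix x assume x: "x \<in> W"
      show "x \<in> insert r (Field R)"
      proof (cases "\<delta> x")
        case 0
        then show ?thesis using W0 x by simp
      next
        case (Suc i)
        then show ?thesis using par[OF x] by (auto simp: Field_def)
      qed
    qed
  qed
qed

text \<open>Without the cycle, two consecutive levels span only linearly many edges. The large
  minimum degree then makes every level at least \<open>q\<close> times as large as the previous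
  one, and level \<open>m\<close> would exceed \<open>V\<close>.\<close>

lemma bipartite_min_degree_cycle:
  fixes R :: "('a \<times> 'a) set"
  assumes "finite V" "R \<subseteq> V \<times> V" "R \<noteq> {}" "sym R"
    and bip: "\<And>x y. (x, y) \<in> R \<Longrightarrow> (x \<in> S) \<noteq> (y \<in> S)"
    and deg: "\<And>v. v \<in> Field R \<Longrightarrow> (q + 3) * (2 * (2 * m + 3)) \<le> card (R `` {v})"
    and q: "1 \<le> q" "card V < q ^ m"
  shows "contains_cycle R (2 * m)"
proof (rule ccontr)
  assume no: "\<not> contains_cycle R (2 * m)"
  obtain r where r: "r \<in> Field R" using \<open>R \<noteq> {}\<close> by (auto simp: Field_def)
  obtain W \<delta> p where lev: "r \<in> W" "\<delta> r = (0::nat)"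
    "\<And>x y. x \<in> W \<Longrightarrow> y \<in> W \<Longrightarrow> \<delta> x = 0 \<Longrightarrow> \<delta> y = 0 \<Longrightarrow> x = y"
    "\<And>x y. x \<in> W \<Longrightarrow> (x, y) \<in> R \<Longrightarrow> y \<in> W \<and> (\<delta> y = Suc (\<delta> x) \<or> \<delta> x = Suc (\<delta> y))"
    "\<And>x i. x \<in> W \<Longrightarrow> \<delta> x = Suc i \<Longrightarrow> p x \<in> W \<and> (p x, x) \<in> R \<and> \<delta> (p x) = i"
    "W \<subseteq> insert r (Field R)"
  proof (rule distance_levels[OF \<open>sym R\<close> bip, where r = r], goal_cases)
    case (2 W \<delta> p)
    from 2(2-) show ?case by (rule 2(1))
  qed
  have WF: "W \<subseteq> Field R" using lev(6) r by auto
  have FV: "Field R \<subseteq> V" using assms(2) by (auto simp: Field_def)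
  have finW: "finite W" using WF FV \<open>finite V\<close> by (meson finite_subset)
  have finR: "finite R" using assms(1,2) by (meson finite_SigmaI finite_subset)
  define L where "L j = {x \<in> W. \<delta> x = j}" for j
  have finL: "finite (L j)" for j using finW by (simp add: L_def)
  define K where "K = 2 * (2 * m + 3)"
  define E where "E j = {(x, y) \<in> R. x \<in> W \<and> (\<delta> x = j \<and> \<delta> y = Suc j \<or> \<delta> x = Suc j \<and> \<delta> y = j)}" for j
  have finE: "finite (E j)" for j using finR by (rule finite_subset[rotated]) (auto simp: E_def)
  have Esym: "sym (E j)" for j
    using \<open>sym R\<close> lev(4) by (auto simp: E_def sym_def)
  \<comment> \<open>More edges would leave a subgraph between the two levels with all degrees above
    \<open>2 * m + 3\<close>, to which \<open>cycle_from_dense_levels\<close> applies; the passage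
    to it costs the factor 2 in \<open>K\<close>.\<close>
  have cE: "card (E j) \<le> K * (card (L j) + card (L (Suc j)))" if "j < m" for j
  proof (rule ccontr)
    assume "\<not> ?thesis"
    then have big: "K * (card (L j) + card (L (Suc j))) < card (E j)" by simp
    have "Field (E j) \<subseteq> L j \<union> L (Suc j)"
      using lev(4) by (auto simp: Field_def E_def L_def)
    then have "card (Field (E j)) \<le> card (L j \<union> L (Suc j))" using finL by (intro card_mono) auto
    also have "\<dots> \<le> card (L j) + card (L (Suc j))" by (rule card_Un_le)
    finally have "K * card (Field (E j)) \<le> K * (card (L j) + card (L (Suc j)))" by (rule mult_le_mono2)
    then have "2 * (2 * m + 3) * card (Field (E j)) < card (E j)" using big unfolding K_def by linarith
    then obtain F where F: "F \<subseteq> E j" "sym F" "F \<noteq> {}" "\<forall>v\<in>Field F. 2 * m + 3 < card (F `` {v})"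
      using min_degree_subgraph[OF finE Esym] by metis
    have "contains_cycle R (2 * m)"
      by (rule cycle_from_dense_levels[OF \<open>sym R\<close> lev(5) lev(3), of F j m])
        (use F that in \<open>auto simp: E_def\<close>)
    then show False using no by simp
  qed
  have dL: "(q + 3) * K * card (L j) \<le> card ({p \<in> R. fst p \<in> L j})" for j
  proof -
    have "{p \<in> R. fst p \<in> L j} = (SIGMA x:L j. R `` {x})" by auto
    then have "card {p \<in> R. fst p \<in> L j} = (\<Sum>x\<in>L j. card (R `` {x}))"
      using finL finR by (simp add: card_SigmaI finite_Image)
    also have "\<dots> \<ge> (\<Sum>x\<in>L j. (q + 3) * K)"
      using deg WF by (intro sum_mono) (auto simp: K_def L_def)
    finally show ?thesis by (simp add: mult.commute)
  qed
  \<comment> \<open>Every edge at level \<open>Suc j\<close> goes to a neighbouring level, so this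
    level is counted twice and the lower one once. The lower one is no larger, and the 3 in
    \<open>q + 3\<close> absorbs all of them.\<close>
  have grow: "q * card (L j) \<le> card (L (Suc j))" if "j < m" for j
    using that
  proof (induction j)
    case 0
    have "{p \<in> R. fst p \<in> L 0} \<subseteq> E 0" using lev(4) by (fastforce simp: L_def E_def)
    then have "card {p \<in> R. fst p \<in> L 0} \<le> card (E 0)" by (rule card_mono[OF finE])
    then have "(q + 3) * K * card (L 0) \<le> K * (card (L 0) + card (L 1))"
      using dL[of 0] cE[OF 0] unfolding One_nat_def by linarith
    then have "K * ((q + 3) * card (L 0)) \<le> K * (card (L 0) + card (L 1))" by (simp add: algebra_simps)
    then have "(q + 3) * card (L 0) \<le> card (L 0) + card (L 1)"
      by (simp add: K_def)
    then show ?case by (simp add: algebra_simps)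
  next
    case (Suc j)
    have "{p \<in> R. fst p \<in> L (Suc j)} \<subseteq> E (Suc j) \<union> E j"
    proof
      fix e assume "e \<in> {p \<in> R. fst p \<in> L (Suc j)}"
      then obtain x y where "e = (x, y)" "(x, y) \<in> R" "x \<in> W" "\<delta> x = Suc j"
        by (cases e) (auto simp: L_def)
      then show "e \<in> E (Suc j) \<union> E j" using lev(4)[of x y] by (auto simp: E_def)
    qed
    then have "card {p \<in> R. fst p \<in> L (Suc j)} \<le> card (E (Suc j) \<union> E j)"
      using finE by (intro card_mono) auto
    also have "\<dots> \<le> card (E (Suc j)) + card (E j)" by (rule card_Un_le)
    also have "\<dots> \<le> K * (card (L (Suc j)) + card (L (Suc (Suc j)))) + K * (card (L j) + card (L (Suc j)))"
      using cE[of "Suc j"] cE[of j] Suc.prems by simp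
    finally have "(q + 3) * K * card (L (Suc j)) \<le> \<dots>" using dL[of "Suc j"] by linarith
    then have "K * ((q + 3) * card (L (Suc j))) \<le>
        K * (2 * card (L (Suc j)) + card (L (Suc (Suc j))) + card (L j))" by (simp add: algebra_simps)
    then have "(q + 3) * card (L (Suc j)) \<le> 2 * card (L (Suc j)) + card (L (Suc (Suc j))) + card (L j)"
      by (simp add: K_def)
    moreover have "card (L j) \<le> card (L (Suc j))"
      using Suc.IH Suc.prems mult_le_mono1[OF q(1), of "card (L j)"] by linarith
    ultimately show ?case by (simp add: algebra_simps)
  qed
  have "q ^ j \<le> card (L j)" if "j \<le> m" for j
    using that
  proof (induction j)
    case 0
    have "L 0 = {r}" using lev(1,2,3) by (auto simp: L_def)
    then show ?case by simp
  next
    case (Suc j)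
    then have "q * q ^ j \<le> q * card (L j)" by (intro mult_le_mono2) simp
    also have "\<dots> \<le> card (L (Suc j))" using grow[of j] Suc.prems by simp
    finally show ?case by simp
  qed
  then have "q ^ m \<le> card (L m)" by simp
  also have "\<dots> \<le> card V" using WF FV \<open>finite V\<close> by (intro card_mono) (auto simp: L_def)
  finally show False using q(2) by simp
qed

text \<open>The factor 8 collects a 2 for the bipartite subgraph, a 2 for the passage to minimum
  degree, and the 2 in the degree that \<open>bipartite_min_degree_cycle\<close> requires.\<close>

lemma Bondy_Simonovits_nat:
  fixes R :: "('a \<times> 'a) set"
  assumes "finite V" "R \<subseteq> V \<times> V" "sym R" "irrefl R" "\<not> contains_cycle R (2 * m)"
    and q: "1 \<le> q" "card V < q ^ m"
  shows "card R \<le> 8 * (2 * m + 3) * (q + 3) * card V"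
proof (rule ccontr)
  assume "\<not> ?thesis"
  then have big: "8 * (2 * m + 3) * (q + 3) * card V < card R" by simp
  obtain S where S: "card R \<le> 2 * card {(x, y) \<in> R. (x \<in> S) \<noteq> (y \<in> S)}"
    using bipartite_subgraph[OF assms(1-4)] by auto
  define B where "B = {(x, y) \<in> R. (x \<in> S) \<noteq> (y \<in> S)}"
  have BR: "B \<subseteq> R" by (auto simp: B_def)
  then have "B \<subseteq> V \<times> V" using assms(2) by simp
  then have finB: "finite B" using assms(1) by (meson finite_SigmaI finite_subset)
  have "sym B" using \<open>sym R\<close> by (auto simp: B_def sym_def)
  define d where "d = (q + 3) * (2 * (2 * m + 3))"
  have FV: "Field B \<subseteq> V" using assms(2) by (auto simp: B_def Field_def)
  have "2 * d * card (Field B) \<le> 2 * d * card V"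
    using FV \<open>finite V\<close> by (intro mult_le_mono2 card_mono)
  also have "\<dots> < card B" using big S unfolding B_def[symmetric] d_def by (simp add: algebra_simps)
  finally obtain R' where R': "R' \<subseteq> B" "sym R'" "R' \<noteq> {}" "\<forall>v\<in>Field R'. d < card (R' `` {v})"
    using min_degree_subgraph[OF finB \<open>sym B\<close>] by blast
  have "contains_cycle R' (2 * m)"
  proof (rule bipartite_min_degree_cycle[OF \<open>finite V\<close> _ R'(3,2) _ _ q])
    show "R' \<subseteq> V \<times> V" using R'(1) assms(2) by (auto simp: B_def)
    show "(x \<in> S) \<noteq> (y \<in> S)" if "(x, y) \<in> R'" for x y using R'(1) that by (auto simp: B_def)
    show "(q + 3) * (2 * (2 * m + 3)) \<le> card (R' `` {v})" if "v \<in> Field R'" for v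
      using R'(4) that by (simp add: d_def less_imp_le)
  qed
  then show False using assms(5) contains_cycle_mono[of R' "2 * m" R] R'(1) BR by simp
qed

text \<open>\<open>q\<close> is the least integer above the \<open>m\<close>-th root
  \<open>x\<close> of the number of vertices. As \<open>1 \<le> x\<close>,
  \<open>q + 3 \<le> x + 4 \<le> 5 * x\<close>, and 8 times 5 is 40.\<close>

lemma Bondy_Simonovits:
  fixes R :: "('a \<times> 'a) set"
  assumes "finite V" "R \<subseteq> V \<times> V" "sym R" "irrefl R" "\<not> contains_cycle R (2 * m)" "1 \<le> m"
  shows "real (card R) \<le> 40 * (2 * real m + 3) * real (card V) powr (1 + 1 / real m)"
proof (cases "V = {}")
  case True
  then show ?thesis using assms(2) by simp
next
  case False
  define n where "n = real (card V)"
  have n: "1 \<le> n" using False \<open>finite V\<close> by (simp add: n_def Suc_leI card_gt_0_iff)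
  define x where "x = n powr (1 / real m)"
  have x: "1 \<le> x" using n by (simp add: x_def ge_one_powr_ge_zero)
  have xm: "x ^ m = n" using n \<open>1 \<le> m\<close> by (simp add: x_def powr_power)
  define q where "q = nat \<lfloor>x\<rfloor> + 1"
  have q: "x < real q" "real q \<le> x + 1" using x by (auto simp: q_def) linarith+
  have "real (card V) < real (q ^ m)"
    using power_strict_mono[OF q(1), of m] x \<open>1 \<le> m\<close> xm by (simp add: n_def)
  then have "card V < q ^ m" by linarith
  then have "card R \<le> 8 * (2 * m + 3) * (q + 3) * card V"
    using Bondy_Simonovits_nat[OF assms(1-5), of q] by (simp add: q_def)
  then have "real (card R) \<le> real (8 * (2 * m + 3) * (q + 3) * card V)" by (rule of_nat_mono)
  also have "\<dots> = 8 * (2 * real m + 3) * (real q + 3) * n" by (simp add: n_def)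
  also have "\<dots> \<le> 8 * (2 * real m + 3) * (5 * x) * n"
    using q x n by (intro mult_right_mono mult_left_mono) auto
  also have "\<dots> = 40 * (2 * real m + 3) * (n * x)" by simp
  also have "n * x = n powr (1 + 1 / real m)" using n by (simp add: x_def powr_add)
  finally show ?thesis by (simp add: n_def)
qed

section \<open>Full sets\<close>

text \<open>Turns a path in the graph of full pairs over W into a path of F.\<close>

fun zigzag :: "'a set \<Rightarrow> 'a list \<Rightarrow> 'a set list" where
  "zigzag W [] = []"
| "zigzag W [x] = [insert x W]"
| "zigzag W (x # y # xs) = insert x W # insert x (insert y W) # zigzag W (y # xs)"

lemma length_zigzag: "length (zigzag W xs) = 2 * length xs - 1"
  by (induction W xs rule: zigzag.induct) auto

lemma zigzag_eq_Nil [simp]: "zigzag W xs = [] \<longleftrightarrow> xs = []"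
  by (induction W xs rule: zigzag.induct) auto

lemma hd_zigzag: "xs \<noteq> [] \<Longrightarrow> hd (zigzag W xs) = insert (hd xs) W"
  by (induction W xs rule: zigzag.induct) auto

lemma last_zigzag: "xs \<noteq> [] \<Longrightarrow> last (zigzag W xs) = insert (last xs) W"
  by (induction W xs rule: zigzag.induct) auto

lemma zigzag_subset: "A \<in> set (zigzag W xs) \<Longrightarrow> A \<subseteq> W \<union> set xs"
  by (induction W xs rule: zigzag.induct) auto

text \<open>The two sets put in front contain the head of the list, and no later set does.\<close>

lemma distinct_zigzag:
  "distinct xs \<Longrightarrow> set xs \<inter> W = {} \<Longrightarrow> distinct (zigzag W xs)"
proof (induction W xs rule: zigzag.induct)
  case (3 W x y xs)
  have "x \<notin> A" if "A \<in> set (zigzag W (y # xs))" for A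
    using zigzag_subset[OF that] 3 by auto
  then have "insert x W \<notin> set (zigzag W (y # xs))"
    "insert x (insert y W) \<notin> set (zigzag W (y # xs))" by auto
  moreover have "insert x W \<noteq> insert x (insert y W)" using 3 by auto
  ultimately show ?case using 3 by auto
qed auto

lemma successively_zigzag:
  assumes "successively (\<lambda>x y. (x, y) \<in> R) xs"
    and "\<And>x y. (x, y) \<in> R \<Longrightarrow>
      adj F (insert x W) (insert x (insert y W)) \<and> adj F (insert x (insert y W)) (insert y W)"
  shows "successively (adj F) (zigzag W xs)"
  using assms
  by (induction W xs rule: zigzag.induct) (auto simp: successively_Cons hd_zigzag)

text \<open>A vertex \<open>x\<close> becomes \<open>insert x w\<close>, and an edge becomes the set
  with both of its ends, which doubles the length. For \<open>n = 2\<close> the two edges would give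
  the same set, hence \<open>3 \<le> n\<close>.\<close>

lemma contains_cycle_zigzag:
  assumes R: "sym R" "\<And>x y. (x, y) \<in> R \<Longrightarrow> x \<noteq> y \<and> x \<notin> w \<and> y \<notin> w \<and>
      adj F (insert x w) (insert x (insert y w))"
    and c: "contains_cycle R n" and n: "3 \<le> n"
  shows "contains_cycle F (2 * n)"
proof -
  obtain f where f: "inj_on f {..<n}" "\<And>i. i < n \<Longrightarrow> (f i, f (Suc i mod n)) \<in> R"
    using c adj_sym_rel[OF R(1)] by (auto simp: contains_cycle_def)
  define xs where "xs = map f [0..<n]"
  have R2: "adj F (insert x w) (insert x (insert y w)) \<and> adj F (insert x (insert y w)) (insert y w)"
    if "(x, y) \<in> R" for x y
    using R(2)[OF that] R(2)[of y x] that R(1) by (auto simp: adj_def insert_commute dest: symD)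
  have xs_ne: "xs \<noteq> []" using n by (simp add: xs_def)
  have len: "length xs = n" by (simp add: xs_def)
  have dis: "distinct xs" using f(1) by (simp add: xs_def distinct_map lessThan_atLeast0)
  have succ: "successively (\<lambda>x y. (x, y) \<in> R) xs"
    unfolding successively_conv_nth
  proof (intro allI impI)
    fix i assume "Suc i < length xs"
    then show "(xs ! i, xs ! Suc i) \<in> R" using f(2)[of i] by (simp add: xs_def)
  qed
  have disw: "set xs \<inter> w = {}"
    using f(2) R(2) by (fastforce simp: xs_def)
  have hl: "hd xs = f 0" "last xs = f (n - 1)"
    using n by (auto simp: xs_def hd_map last_map)
  have lr: "(f (n - 1), f 0) \<in> R" using f(2)[of "n - 1"] n by simp
  obtain x y ys where xs: "xs = x # y # ys" "ys \<noteq> []"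
    using len n by (cases xs; cases "tl xs"; cases "tl (tl xs)") auto
  define z where "z = last xs"
  have zm: "z \<in> set ys" using xs by (simp add: z_def)
  have x0: "x = f 0" using hl xs by simp
  \<comment> \<open>\<open>zigzag\<close> treats \<open>xs\<close> as a path; the appended set
    belongs to the edge that closes the cycle.\<close>
  define cs where "cs = zigzag w xs @ [insert x (insert z w)]"
  have "insert x (insert z w) \<notin> set (zigzag w xs)"
  proof -
    have "x \<notin> A" if "A \<in> set (zigzag w (y # ys))" for A
      using zigzag_subset[OF that] dis disw xs by auto
    then have "insert x (insert z w) \<notin> set (zigzag w (y # ys))" by auto
    moreover have "insert x w \<noteq> insert x (insert z w)"
      "insert x (insert y w) \<noteq> insert x (insert z w)" using zm dis disw xs by auto
    ultimately show ?thesis by (auto simp: xs)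
  qed
  then have "distinct cs" using distinct_zigzag[OF dis disw] by (simp add: cs_def)
  moreover have "successively (adj F) cs"
    unfolding cs_def successively_append_iff
    using successively_zigzag[OF succ R2] R2[OF lr] xs_ne hl x0
    by (auto simp: last_zigzag z_def insert_commute)
  moreover have "adj F (last cs) (hd cs)"
    using R2[OF lr] xs_ne hl x0
    by (auto simp: cs_def hd_zigzag z_def insert_commute)
  moreover have "length cs = 2 * n" using n len by (simp add: cs_def length_zigzag)
  ultimately show ?thesis using contains_cycleI[of cs F] by (simp add: cs_def)
qed

section \<open>Degrees and double counting of full sets\<close>

lemma doubled_odd_edges_iff:
  "(u, v) \<in> doubled_odd_edges k \<longleftrightarrow> v \<subseteq> {..<2 * k + 1} \<and> card v = k + 1 \<and> (\<exists>x\<in>v. u = v - {x})"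
proof -
  have "\<exists>x\<in>v. u = v - {x}" if "card u = k" "v \<subseteq> {..<2 * k + 1}" "card v = k + 1" "u \<subset> v"
  proof -
    have fin: "finite v" using that(2) finite_subset by blast
    have "card (v - u) = 1" using that fin by (subst card_Diff_subset) (auto intro: finite_subset)
    then obtain x where x: "v - u = {x}" by (auto simp: card_1_singleton_iff)
    then have "u = v - {x}" "x \<in> v" using that(4) by auto
    then show ?thesis by blast
  qed
  moreover have "card (v - {x}) = k" if "card v = k + 1" "x \<in> v" for x
    using that by (simp add: card_Diff_singleton)
  ultimately show ?thesis
    unfolding doubled_odd_edges_def doubled_johnson_edges_def by auto
qed

lemma finite_doubled_odd_edges: "finite (doubled_odd_edges k)"
proof (rule finite_subset)
  show "doubled_odd_edges k \<subseteq> Pow {..<2 * k + 1} \<times> Pow {..<2 * k + 1}"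
    by (auto simp: doubled_odd_edges_def doubled_johnson_edges_def)
qed auto

lemma ex_cycle_le:
  assumes "1 \<le> m"
    and "\<And>F. F \<subseteq> doubled_odd_edges k \<Longrightarrow> \<not> contains_cycle F m \<Longrightarrow> real (card F) \<le> B"
  shows "real (ex_cycle (doubled_odd_edges k) m) \<le> B"
proof -
  let ?S = "{F. F \<subseteq> doubled_odd_edges k \<and> \<not> contains_cycle F m}"
  have "finite ?S"
    by (rule finite_subset[of _ "Pow (doubled_odd_edges k)"])
      (use finite_doubled_odd_edges in auto)
  \<comment> \<open>For \<open>m = 0\<close> every graph contains the cycle vacuously and the
    maximum would range over the empty set; \<open>1 \<le> m\<close> makes the empty graph
    admissible.\<close>
  moreover have "{} \<in> ?S"
    using \<open>1 \<le> m\<close> by (auto simp: contains_cycle_def adj_def intro!: exI[of _ 0])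
  ultimately have "Max (card ` ?S) \<in> card ` ?S" by (intro Max_in) auto
  then show ?thesis using assms(2) unfolding ex_cycle_def by auto
qed

definition top_vertices :: "nat \<Rightarrow> nat set set" where
  "top_vertices k = {v. v \<subseteq> {..<2 * k + 1} \<and> card v = k + 1}"

definition down_set :: "(nat set \<times> nat set) set \<Rightarrow> nat set \<Rightarrow> nat set" where
  "down_set F v = {x \<in> v. (v - {x}, v) \<in> F}"

definition full_sets :: "(nat set \<times> nat set) set \<Rightarrow> nat \<Rightarrow> nat set \<Rightarrow> nat set set" where
  "full_sets F r w = {T. card T = r \<and> T \<inter> w = {} \<and> (\<forall>x\<in>T. (w \<union> T - {x}, w \<union> T) \<in> F)}"

lemma finite_top_vertices: "finite (top_vertices k)"
  by (simp add: top_vertices_def)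

lemma finite_down_set: "v \<in> top_vertices k \<Longrightarrow> finite (down_set F v)"
  by (auto simp: top_vertices_def down_set_def intro: finite_subset)

lemma card_top_vertices: "card (top_vertices k) = (2 * k + 1) choose k"
  using n_subsets[of "{..<2 * k + 1}" "k + 1"] binomial_symmetric[of "k + 1" "2 * k + 1"]
  by (simp add: top_vertices_def)

lemma card_le_sum_down_set:
  assumes "F \<subseteq> doubled_odd_edges k"
  shows "card F \<le> (\<Sum>v\<in>top_vertices k. card (down_set F v))"
proof -
  have "F \<subseteq> (\<lambda>(v, x). (v - {x}, v)) ` (SIGMA v:top_vertices k. down_set F v)"
  proof
    fix e assume e: "e \<in> F"
    obtain u v where uv: "e = (u, v)" by (cases e)
    then obtain x where "v \<subseteq> {..<2 * k + 1}" "card v = k + 1" "x \<in> v" "u = v - {x}"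
      using e subsetD[OF assms, of "(u, v)"] doubled_odd_edges_iff[of u v k] by auto
    then show "e \<in> (\<lambda>(v, x). (v - {x}, v)) ` (SIGMA v:top_vertices k. down_set F v)"
      using e uv by (intro image_eqI[of _ _ "(v, x)"]) (auto simp: top_vertices_def down_set_def)
  qed
  then have "card F \<le> card (SIGMA v:top_vertices k. down_set F v)"
    using finite_top_vertices finite_down_set by (intro surj_card_le) auto
  then show ?thesis using finite_top_vertices finite_down_set by simp
qed

lemma card_doubled_odd_edges_ge:
  "(k + 1) * card (top_vertices k) \<le> card (doubled_odd_edges k)"
proof -
  have fin: "finite v" if "v \<in> top_vertices k" for v
    using that by (auto simp: top_vertices_def intro: finite_subset)
  have "inj_on (\<lambda>(v, x). (v - {x}, v)) (SIGMA v:top_vertices k. v)"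
    by (auto simp: inj_on_def)
  moreover have "(\<lambda>(v, x). (v - {x}, v)) ` (SIGMA v:top_vertices k. v) \<subseteq> doubled_odd_edges k"
    by (auto simp: doubled_odd_edges_iff top_vertices_def)
  ultimately have "card (SIGMA v:top_vertices k. v) \<le> card (doubled_odd_edges k)"
    using finite_doubled_odd_edges by (rule card_inj_on_le)
  moreover have "card (SIGMA v:top_vertices k. v) = (\<Sum>v\<in>top_vertices k. card v)"
    using fin finite_top_vertices by simp
  moreover have "\<dots> = (\<Sum>v\<in>top_vertices k. k + 1)"
    by (rule sum.cong) (auto simp: top_vertices_def)
  ultimately show ?thesis by (simp add: mult.commute)
qed

text \<open>A nonempty full set carries an edge of \<open>F\<close> whose upper end contains it, and
  this end lies in the ground set.\<close>

lemma finite_full_sets: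
  assumes "F \<subseteq> doubled_odd_edges k" "1 \<le> r"
  shows "finite (full_sets F r w)" "T \<in> full_sets F r w \<Longrightarrow> T \<subseteq> {..<2 * k + 1}"
proof -
  show *: "T \<subseteq> {..<2 * k + 1}" if T: "T \<in> full_sets F r w" for T
  proof -
    have "T \<noteq> {}" using T \<open>1 \<le> r\<close> by (auto simp: full_sets_def)
    then obtain x where "x \<in> T" by auto
    then have "(w \<union> T - {x}, w \<union> T) \<in> doubled_odd_edges k"
      using T assms(1) unfolding full_sets_def by blast
    then show ?thesis unfolding doubled_odd_edges_iff by auto
  qed
  then have "full_sets F r w \<subseteq> Pow {..<2 * k + 1}" by auto
  then show "finite (full_sets F r w)" by (rule finite_subset) simp
qed

text \<open>Double counting: an \<open>r\<close>-set \<open>T\<close> inside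
  \<open>down_set F v\<close> is full over \<open>v - T\<close>, and \<open>(v - T, T)\<close>
  determines \<open>v\<close>. The number of possible \<open>w\<close> is at most the central
  binomial coefficient, which is the number of top vertices.\<close>

lemma sum_choose_down_set_le:
  assumes F: "F \<subseteq> doubled_odd_edges k" and r: "1 \<le> r" "r \<le> k + 1"
    and M: "\<And>w. real (card (full_sets F r w)) \<le> M"
  shows "(\<Sum>v\<in>top_vertices k. real (card (down_set F v) choose r)) \<le> real (card (top_vertices k)) * M"
proof -
  let ?n = "2 * k + 1"
  define Ws where "Ws = {w. w \<subseteq> {..<?n} \<and> card w = k + 1 - r}"
  have fW: "finite Ws" by (simp add: Ws_def)
  define A where "A = (SIGMA v:top_vertices k. {T. T \<subseteq> down_set F v \<and> card T = r})"
  define B where "B = (SIGMA w:Ws. full_sets F r w)"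
  have finv: "finite v" if "v \<in> top_vertices k" for v
    using that by (auto simp: top_vertices_def intro: finite_subset)
  have fT: "finite {T. T \<subseteq> down_set F v \<and> card T = r}" if "v \<in> top_vertices k" for v
    using finite_down_set[OF that] by simp
  have "card A = (\<Sum>v\<in>top_vertices k. card {T. T \<subseteq> down_set F v \<and> card T = r})"
    unfolding A_def using fT finite_top_vertices by simp
  also have "\<dots> = (\<Sum>v\<in>top_vertices k. card (down_set F v) choose r)"
    by (intro sum.cong refl n_subsets finite_down_set)
  finally have cA: "card A = (\<Sum>v\<in>top_vertices k. card (down_set F v) choose r)" .
  have "inj_on (\<lambda>(v, T). (v - T, T)) A"
    by (auto simp: inj_on_def A_def down_set_def)
  moreover have "(\<lambda>(v, T). (v - T, T)) ` A \<subseteq> B"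
  proof -
    have "v - T \<in> Ws \<and> T \<in> full_sets F r (v - T)"
      if v: "v \<in> top_vertices k" and T: "T \<subseteq> down_set F v" "card T = r" for v T
    proof -
      have Tv: "T \<subseteq> v" using T by (auto simp: down_set_def)
      then have "v - T \<union> T = v" by auto
      moreover have "card (v - T) = k + 1 - r"
        using Tv T v finv[OF v] by (simp add: card_Diff_subset finite_subset top_vertices_def)
      ultimately show ?thesis
        using T v by (auto simp: Ws_def full_sets_def top_vertices_def down_set_def)
    qed
    then show ?thesis by (auto simp: A_def B_def)
  qed
  moreover have "finite B" unfolding B_def using fW finite_full_sets[OF F r(1)] by auto
  ultimately have "card A \<le> card B" by (rule card_inj_on_le)
  then have "(\<Sum>v\<in>top_vertices k. real (card (down_set F v) choose r)) \<le> real (card B)"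
    unfolding cA by (metis of_nat_le_iff of_nat_sum)
  also have "card B = (\<Sum>w\<in>Ws. card (full_sets F r w))"
    unfolding B_def using fW finite_full_sets[OF F r(1)] by simp
  also have "real \<dots> \<le> (\<Sum>w\<in>Ws. M)" unfolding of_nat_sum by (intro sum_mono M)
  also have "\<dots> = real (card Ws) * M" by simp
  also have "card Ws = ?n choose (k + 1 - r)" unfolding Ws_def by (subst n_subsets) auto
  also have "real \<dots> * M \<le> real (card (top_vertices k)) * M"
  proof (rule mult_right_mono)
    show "0 \<le> M" using M[of "{}"] by (meson of_nat_0_le_iff order_trans)
    show "real (?n choose (k + 1 - r)) \<le> real (card (top_vertices k))"
      using binomial_maximum[of ?n "k + 1 - r"] by (simp add: card_top_vertices)
  qed
  finally show ?thesis .
qed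

text \<open>\<open>\<tau>\<close> is a degree threshold. A degree up to \<open>r * \<tau>\<close> is
  accepted as it is; for larger \<open>d\<close> the bound
  \<open>(d / r) ^ r \<le> d choose r\<close> gives
  \<open>d \<le> r * ((d choose r) / \<tau> ^ (r - 1))\<close>. The form
  \<open>c * \<tau> ^ r\<close> makes both contributions proportional to \<open>\<tau>\<close>,
  against \<open>k + 1\<close> edges of the whole graph below each top vertex.\<close>

lemma card_le_of_full_sets_le:
  assumes F: "F \<subseteq> doubled_odd_edges k" and r: "1 \<le> r" "r \<le> k + 1" and k: "1 \<le> k"
    and \<tau>: "1 \<le> \<tau>" and M: "\<And>w. real (card (full_sets F r w)) \<le> c * \<tau> ^ r"
  shows "real (card F) \<le> real r * (1 + c) * (\<tau> / k * card (doubled_odd_edges k))"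
proof -
  define N where "N = real (card (top_vertices k))"
  have pt: "real d \<le> r * \<tau> + r * (real (d choose r) / \<tau> ^ (r - 1))" for d
  proof (cases "real d \<le> r * \<tau>")
    case True
    have "0 \<le> r * (real (d choose r) / \<tau> ^ (r - 1))" using \<tau> by simp
    then show ?thesis using True by linarith
  next
    case False
    then have lt: "\<tau> \<le> real d / r" using r by (simp add: field_simps)
    have "real r * 1 \<le> r * \<tau>" using \<tau> by (intro mult_left_mono) auto
    then have "r \<le> d" using False by linarith
    have "real d / r * \<tau> ^ (r - 1) \<le> real d / r * (real d / r) ^ (r - 1)"
      using lt \<tau> by (intro mult_left_mono power_mono) auto
    also have "\<dots> = (real d / r) ^ r" using r by (simp flip: power_Suc)
    also have "\<dots> \<le> real (d choose r)" using binomial_ge_n_over_k_pow_k[OF \<open>r \<le> d\<close>, where 'a = real] by simp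
    finally have "real d \<le> r * (real (d choose r) / \<tau> ^ (r - 1))" using \<tau> r by (simp add: field_simps)
    moreover have "0 \<le> r * \<tau>" using \<tau> by simp
    ultimately show ?thesis by linarith
  qed
  have "real (card F) \<le> (\<Sum>v\<in>top_vertices k. real (card (down_set F v)))"
    using card_le_sum_down_set[OF F] by (metis of_nat_le_iff of_nat_sum)
  also have "\<dots> \<le> (\<Sum>v\<in>top_vertices k. r * \<tau> + r * (real (card (down_set F v) choose r) / \<tau> ^ (r - 1)))"
    by (intro sum_mono pt)
  also have "\<dots> = N * (r * \<tau>) +
      r * ((\<Sum>v\<in>top_vertices k. real (card (down_set F v) choose r)) / \<tau> ^ (r - 1))"
    by (simp add: sum.distrib N_def flip: sum_distrib_left sum_divide_distrib)
  also have "\<dots> \<le> N * (r * \<tau>) + r * (N * (c * \<tau> ^ r) / \<tau> ^ (r - 1))"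
    using sum_choose_down_set_le[OF F r M] \<tau>
    by (intro add_left_mono mult_left_mono divide_right_mono) (auto simp: N_def)
  also have "\<tau> ^ r = \<tau> * \<tau> ^ (r - 1)" using r by (simp flip: power_Suc)
  also have "N * (r * \<tau>) + r * (N * (c * (\<tau> * \<tau> ^ (r - 1))) / \<tau> ^ (r - 1)) = r * (1 + c) * (\<tau> * N)"
    using \<tau> by (simp add: field_simps)
  also have "\<dots> \<le> r * (1 + c) * (\<tau> / k * card (doubled_odd_edges k))"
  proof (rule mult_left_mono)
    have "0 \<le> c * \<tau> ^ r" using M[of "{}"] by (meson of_nat_0_le_iff order_trans)
    moreover have "0 < \<tau> ^ r" using \<tau> by simp
    ultimately have "0 \<le> c" by (simp add: zero_le_mult_iff)
    then show "0 \<le> r * (1 + c)" by simp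
    have "real k * N \<le> real ((k + 1) * card (top_vertices k))" by (simp add: N_def algebra_simps)
    also have "\<dots> \<le> card (doubled_odd_edges k)" using card_doubled_odd_edges_ge of_nat_mono by blast
    finally have "\<tau> * (real k * N) \<le> \<tau> * card (doubled_odd_edges k)" using \<tau> by (intro mult_left_mono) auto
    then show "\<tau> * N \<le> \<tau> / k * card (doubled_odd_edges k)" using k by (simp add: field_simps)
  qed
  finally show ?thesis .
qed

section \<open>Cycles of length 4l\<close>

lemma full_pairs_le:
  assumes F: "F \<subseteq> doubled_odd_edges k" and no: "\<not> contains_cycle F (4 * l)" and l: "2 \<le> l"
  shows "real (card (full_sets F 2 w)) \<le> 40 * (2 * real l + 3) * real (2 * k + 1) powr (1 + 1 / real l)"
proof -
  define R where "R = {(a, b). a \<noteq> b \<and> {a, b} \<in> full_sets F 2 w}"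
  have RV: "R \<subseteq> {..<2 * k + 1} \<times> {..<2 * k + 1}"
    using finite_full_sets(2)[OF F, of 2 "{a, b}" w for a b] by (auto simp: R_def)
  have symR: "sym R" by (auto simp: R_def sym_def insert_commute)
  have "irrefl R" by (auto simp: R_def irrefl_def)
  have edge: "x \<noteq> y \<and> x \<notin> w \<and> y \<notin> w \<and> adj F (insert x w) (insert x (insert y w))"
    if "(x, y) \<in> R" for x y
  proof -
    have *: "x \<noteq> y" "{x, y} \<inter> w = {}" "(w \<union> {x, y} - {y}, w \<union> {x, y}) \<in> F"
      using that by (auto simp: R_def full_sets_def)
    then have "w \<union> {x, y} - {y} = insert x w" "w \<union> {x, y} = insert x (insert y w)" by auto
    then show ?thesis using * by (auto simp: adj_def)
  qed
  have "\<not> contains_cycle R (2 * l)"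
    using contains_cycle_zigzag[OF symR edge, of "2 * l"] no l by (auto simp: mult.assoc[symmetric])
  then have "real (card R) \<le> 40 * (2 * real l + 3) * real (card {..<2 * k + 1}) powr (1 + 1 / real l)"
    using Bondy_Simonovits[OF _ RV symR \<open>irrefl R\<close>] l by simp
  moreover have "card (full_sets F 2 w) \<le> card R"
  proof (rule surj_card_le)
    show "finite R" using RV by (rule finite_subset) simp
    show "full_sets F 2 w \<subseteq> (\<lambda>(a, b). {a, b}) ` R"
    proof
      fix T assume T: "T \<in> full_sets F 2 w"
      then obtain a b where "T = {a, b}" "a \<noteq> b" by (auto simp: full_sets_def card_2_iff)
      then show "T \<in> (\<lambda>(a, b). {a, b}) ` R"
        using T by (intro image_eqI[of _ _ "(a, b)"]) (auto simp: R_def)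
    qed
  qed
  ultimately show ?thesis by simp
qed

text \<open>The range of \<open>p\<close> covers the exponent for full pairs and the exponent
  \<open>5 / 2\<close> for full triples; 27 is the cube of the 3 in
  \<open>2 * k + 1 \<le> 3 * k\<close>.\<close>

lemma card_odd_powr_le:
  assumes "1 \<le> k" "0 \<le> p" "p \<le> 3"
  shows "real (2 * k + 1) powr p \<le> 27 * real k powr p"
proof -
  have "real (2 * k + 1) powr p \<le> (3 * real k) powr p"
    using assms by (intro powr_mono2) auto
  also have "\<dots> = 3 powr p * real k powr p" by (simp add: powr_mult)
  also have "3 powr p \<le> (3::real) powr 3" using assms by (intro powr_mono) auto
  finally show ?thesis by (simp add: mult_right_mono)
qed

lemma card_C4l_free_le:
  assumes l: "2 \<le> l"
  shows "\<exists>C\<ge>0. \<forall>k\<ge>1. \<forall>F\<subseteq>doubled_odd_edges k. \<not> contains_cycle F (4 * l) \<longrightarrow>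
    real (card F) \<le> C * (real k powr (- 1 / 2 + 1 / (2 * real l)) * real (card (doubled_odd_edges k)))"
proof (intro exI conjI allI impI)
  define c where "c = 40 * (2 * real l + 3) * 27"
  show "0 \<le> 2 * (1 + c)" by (simp add: c_def)
  fix k F assume k: "1 \<le> k" and F: "F \<subseteq> doubled_odd_edges k" and no: "\<not> contains_cycle F (4 * l)"
  \<comment> \<open>Up to a constant, the square root of the bound for full pairs.\<close>
  define \<tau> where "\<tau> = real k powr (1 / 2 + 1 / (2 * real l))"
  have \<tau>1: "1 \<le> \<tau>" using k by (simp add: \<tau>_def ge_one_powr_ge_zero)
  have \<tau>2: "\<tau> ^ 2 = real k powr (1 + 1 / real l)"
    unfolding \<tau>_def power2_eq_square powr_add[symmetric] by (simp add: add_divide_distrib[symmetric])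
  have M: "real (card (full_sets F 2 w)) \<le> c * \<tau> ^ 2" for w
  proof -
    have "real (card (full_sets F 2 w)) \<le> 40 * (2 * real l + 3) * real (2 * k + 1) powr (1 + 1 / real l)"
      by (rule full_pairs_le[OF F no l])
    also have "\<dots> \<le> 40 * (2 * real l + 3) * (27 * real k powr (1 + 1 / real l))"
      using k l by (intro mult_left_mono card_odd_powr_le) (auto simp: field_simps)
    also have "\<dots> = c * \<tau> ^ 2" unfolding c_def \<tau>2 by (rule mult.assoc[symmetric])
    finally show ?thesis .
  qed
  have "real (card F) \<le> real 2 * (1 + c) * (\<tau> / k * card (doubled_odd_edges k))"
    using k by (intro card_le_of_full_sets_le[OF F _ _ k \<tau>1 M]) auto
  also have "\<tau> / k = real k powr (- 1 / 2 + 1 / (2 * real l))"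
  proof -
    have "\<tau> / k = real k powr (1 / 2 + 1 / (2 * real l)) / real k powr 1"
      using k by (simp add: \<tau>_def)
    also have "\<dots> = real k powr (1 / 2 + 1 / (2 * real l) - 1)" by (rule powr_diff[symmetric])
    finally show ?thesis by simp
  qed
  finally show "real (card F) \<le> 2 * (1 + c) *
      (real k powr (- 1 / 2 + 1 / (2 * real l)) * real (card (doubled_odd_edges k)))" by simp
qed

section \<open>Cycles of length 4l + 2\<close>

text \<open>The edge from \<open>a\<close> to \<open>c\<close> is left out and assumed separately
  where the notion is applied; with it the path closes to a cycle of length
  \<open>n\<close>.\<close>

definition on_cycle :: "('a \<times> 'a) set \<Rightarrow> nat \<Rightarrow> 'a \<Rightarrow> 'a \<Rightarrow> bool" where
  "on_cycle R n a c \<longleftrightarrow> (\<exists>zs. length zs = n \<and> distinct zs \<and>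
     successively (\<lambda>x y. (x, y) \<in> R) zs \<and> hd zs = c \<and> last zs = a)"

text \<open>A cycle made of bad edges would be a cycle of \<open>R\<close> through each of them. So
  the bad edges contain no cycle of length \<open>2 * m\<close>, and the Bondy--Simonovits bound
  applies to them.\<close>

lemma card_not_on_cycle_le:
  assumes "finite V" "R \<subseteq> V \<times> V" "sym R" "irrefl R" "1 \<le> m"
  shows "real (card {(a, c) \<in> R. \<not> on_cycle R (2 * m) a c})
    \<le> 40 * (2 * real m + 3) * real (card V) powr (1 + 1 / real m)"
proof (rule Bondy_Simonovits[OF \<open>finite V\<close> _ _ _ _ \<open>1 \<le> m\<close>])
  let ?M = "{(a, c) \<in> R. \<not> on_cycle R (2 * m) a c}"
  have "on_cycle R (2 * m) c a" if ac: "on_cycle R (2 * m) a c" for a c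
  proof -
    obtain zs where zs: "length zs = 2 * m" "distinct zs"
      "successively (\<lambda>x y. (x, y) \<in> R) zs" "hd zs = c" "last zs = a"
      using ac by (auto simp: on_cycle_def)
    have "successively (\<lambda>x y. (y, x) \<in> R) zs"
      using zs(3) by (rule successively_mono) (use \<open>sym R\<close> in \<open>auto dest: symD\<close>)
    then show ?thesis unfolding on_cycle_def using zs
      by (intro exI[of _ "rev zs"]) (auto simp: hd_rev last_rev)
  qed
  then show symM: "sym ?M" using \<open>sym R\<close> by (auto simp: sym_def)
  show "?M \<subseteq> V \<times> V" "irrefl ?M" using assms by (auto simp: irrefl_def)
  show "\<not> contains_cycle ?M (2 * m)"
  proof
    assume "contains_cycle ?M (2 * m)"
    then obtain f where f: "inj_on f {..<2 * m}" "\<And>i. i < 2 * m \<Longrightarrow> (f i, f (Suc i mod (2 * m))) \<in> ?M"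
      unfolding contains_cycle_def adj_sym_rel[OF symM] by blast
    define zs where "zs = map f [1..<2 * m] @ [f 0]"
    have "distinct zs"
    proof -
      have "f 0 \<notin> f ` {1..<2 * m}"
        using inj_onD[OF f(1), of 0] \<open>1 \<le> m\<close> by fastforce
      moreover have "inj_on f {1..<2 * m}" using f(1) by (rule inj_on_subset) auto
      ultimately show ?thesis by (simp add: zs_def distinct_map)
    qed
    moreover have "successively (\<lambda>x y. (x, y) \<in> R) zs"
    proof -
      have "last (map f [1..<2 * m]) = f (2 * m - 1)" using \<open>1 \<le> m\<close> by (simp add: last_map)
      then have "(last (map f [1..<2 * m]), f 0) \<in> R"
        using f(2)[of "2 * m - 1"] \<open>1 \<le> m\<close> by simp
      moreover have "(f (Suc i), f (Suc (Suc i))) \<in> R" if "Suc (Suc i) < 2 * m" for i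
        using f(2)[of "Suc i"] that by simp
      then have "successively (\<lambda>x y. (x, y) \<in> R) (map f [1..<2 * m])"
        by (auto simp: successively_conv_nth)
      ultimately show ?thesis by (simp add: zs_def successively_append_iff)
    qed
    moreover have "hd zs = f 1" "last zs = f 0" "length zs = 2 * m"
      using \<open>1 \<le> m\<close> by (auto simp: zs_def hd_append hd_map)
    ultimately have "on_cycle R (2 * m) (f 0) (f 1)" unfolding on_cycle_def by blast
    moreover have "(f 0, f 1) \<in> ?M" using f(2)[of 0] \<open>1 \<le> m\<close> by simp
    ultimately show False by simp
  qed
qed

text \<open>
  Being in a K(2,3) rather than in a mere 4-cycle leaves two choices for the vertex y, one of which
  avoids the second of the two cycles to be glued.
\<close>

definition in_K23 :: "('a \<times> 'a) set \<Rightarrow> 'a \<Rightarrow> 'a \<Rightarrow> bool" where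
  "in_K23 R b c \<longleftrightarrow> (\<exists>x y y'. x \<noteq> b \<and> y \<noteq> y' \<and> y \<noteq> c \<and> y' \<noteq> c \<and>
     (b, y) \<in> R \<and> (b, y') \<in> R \<and> (x, c) \<in> R \<and> (x, y) \<in> R \<and> (x, y') \<in> R)"

text \<open>Two vertices with three common neighbours along bad edges would put a bad edge into a
  K(2,3). Hence codegrees are at most 2 in the graph of bad edges, and counting paths of length 2
  gives the exponent 3/2, as in the Kovari--Sos--Turan theorem.\<close>

lemma card_not_in_K23_le:
  assumes "finite V" "R \<subseteq> V \<times> V"
  shows "real (card {(b, c) \<in> R. \<not> in_K23 R b c}) \<le> 3 * real (card V) powr (3 / 2)"
proof (cases "V = {}")
  case True
  then have "R = {}" using assms by auto
  then show ?thesis by simp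
next
  case False
  define M where "M = {(b, c) \<in> R. \<not> in_K23 R b c}"
  have MV: "M \<subseteq> V \<times> V" using assms(2) by (auto simp: M_def)
  then have finM: "finite M" using assms(1) by (meson finite_SigmaI finite_subset)
  define n where "n = real (card V)"
  have n: "1 \<le> n" using False assms(1) by (simp add: n_def Suc_leI card_gt_0_iff)
  define f where "f b c = (of_bool ((b, c) \<in> M) :: real)" for b c
  define d where "d c = (\<Sum>b\<in>V. f b c)" for c
  have cM: "(\<Sum>b\<in>V. \<Sum>c\<in>V. f b c) = real (card M)"
  proof -
    have "(\<Sum>b\<in>V. \<Sum>c\<in>V. f b c) = (\<Sum>p\<in>V \<times> V. of_bool (p \<in> M))"
      by (simp add: sum.cartesian_product f_def case_prod_unfold)
    also have "\<dots> = real (card (V \<times> V \<inter> M))"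
      using assms(1) by (simp add: sum_of_bool_eq)
    finally show ?thesis using MV by (simp add: Int_absorb1)
  qed
  have codeg: "(\<Sum>c\<in>V. f b c * f x c) \<le> 2" if "b \<noteq> x" for b x
  proof (rule ccontr)
    let ?S = "{c \<in> V. (b, c) \<in> M \<and> (x, c) \<in> M}"
    assume "\<not> ?thesis"
    moreover have "(\<Sum>c\<in>V. f b c * f x c) = (\<Sum>c\<in>V. of_bool ((b, c) \<in> M \<and> (x, c) \<in> M))"
      by (intro sum.cong) (auto simp: f_def)
    moreover have "\<dots> = real (card ?S)"
      using assms(1) by (simp add: sum_of_bool_eq Int_def)
    ultimately have c3: "3 \<le> card ?S" by linarith
    obtain T where T: "T \<subseteq> ?S" "card T = 3" by (rule obtain_subset_with_card_n[OF c3]) blast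
    obtain c y y' where "T = {c, y, y'}" "c \<noteq> y" "y \<noteq> y'" "c \<noteq> y'"
      using T(2) by (auto simp: card_3_iff)
    moreover from this have "{(b, c), (b, y), (b, y'), (x, c), (x, y), (x, y')} \<subseteq> M" using T(1) by auto
    moreover from this have "{(b, c), (b, y), (b, y'), (x, c), (x, y), (x, y')} \<subseteq> R"
      unfolding M_def by blast
    ultimately have "in_K23 R b c" unfolding in_K23_def using that
      by (intro exI[of _ x] exI[of _ y] exI[of _ y']) simp
    then show False using \<open>{(b, c), (b, y), (b, y'), (x, c), (x, y), (x, y')} \<subseteq> M\<close>
      by (simp add: M_def)
  qed
  have "(\<Sum>c\<in>V. (d c)\<^sup>2) = (\<Sum>c\<in>V. \<Sum>b\<in>V. \<Sum>x\<in>V. f b c * f x c)"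
    by (simp add: d_def power2_eq_square sum_product)
  also have "\<dots> = (\<Sum>b\<in>V. \<Sum>x\<in>V. \<Sum>c\<in>V. f b c * f x c)"
    by (subst sum.swap, rule sum.cong[OF refl], rule sum.swap)
  also have "\<dots> \<le> (\<Sum>b\<in>V. \<Sum>x\<in>V. 2 + (if x = b then (\<Sum>c\<in>V. f b c) else 0))"
  proof (intro sum_mono)
    fix b x
    show "(\<Sum>c\<in>V. f b c * f x c) \<le> 2 + (if x = b then (\<Sum>c\<in>V. f b c) else 0)"
    proof (cases "x = b")
      case True
      have "(\<Sum>c\<in>V. f b c * f b c) = (\<Sum>c\<in>V. f b c)" by (intro sum.cong) (auto simp: f_def)
      then show ?thesis using True by simp
    next
      case False
      then show ?thesis using codeg[of b x] by simp
    qed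
  qed
  also have "\<dots> = 2 * n * n + (\<Sum>b\<in>V. \<Sum>c\<in>V. f b c)"
    using assms(1) by (simp add: sum.distrib n_def)
  finally have sq: "(\<Sum>c\<in>V. (d c)\<^sup>2) \<le> 2 * n * n + real (card M)" by (simp add: cM)
  have "2 * sqrt n * real (card M) = (\<Sum>c\<in>V. 2 * sqrt n * d c)"
    unfolding cM[symmetric] d_def sum_distrib_left[symmetric] by (subst sum.swap) simp
  also have "\<dots> \<le> (\<Sum>c\<in>V. (d c)\<^sup>2 + n)"
  proof (intro sum_mono)
    fix c
    \<comment> \<open>This square replaces Cauchy--Schwarz; \<open>sqrt n\<close> is the order of
      the average degree in the extremal case.\<close>
    have "0 \<le> (d c - sqrt n)\<^sup>2" by simp
    then show "2 * sqrt n * d c \<le> (d c)\<^sup>2 + n" using n by (simp add: power2_diff algebra_simps)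
  qed
  also have "\<dots> \<le> 3 * n * n + real (card M)" using sq by (simp add: sum.distrib n_def)
  finally have "(2 * sqrt n - 1) * real (card M) \<le> 3 * n * n" by (simp add: algebra_simps)
  moreover have "sqrt n * real (card M) \<le> (2 * sqrt n - 1) * real (card M)"
    using n by (intro mult_right_mono) auto
  ultimately have "sqrt n * real (card M) \<le> 3 * n * n" by linarith
  also have "\<dots> = sqrt n * (3 * (sqrt n * n))" using n by (simp add: mult.assoc[symmetric])
  finally have "real (card M) \<le> 3 * (sqrt n * n)" using n by simp
  also have "sqrt n * n = n powr (1 / 2) * n powr 1" using n by (simp add: powr_half_sqrt)
  also have "\<dots> = n powr (3 / 2)" unfolding powr_add[symmetric] by simp
  finally show ?thesis by (simp add: M_def n_def)
qed

section \<open>Links of full triples and the gluing of two cycles\<close>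

definition link :: "(nat set \<times> nat set) set \<Rightarrow> nat set \<Rightarrow> nat \<Rightarrow> (nat \<times> nat) set" where
  "link F w a = {(b, c). a \<noteq> b \<and> a \<noteq> c \<and> b \<noteq> c \<and> {a, b, c} \<in> full_sets F 3 w}"

lemma link_adj:
  assumes "(b, c) \<in> link F w a"
  shows "adj F (w \<union> {a, b}) (w \<union> {a, b, c})" "adj F (w \<union> {a, c}) (w \<union> {a, b, c})"
    "adj F (w \<union> {b, c}) (w \<union> {a, b, c})"
proof -
  have *: "a \<noteq> b" "a \<noteq> c" "b \<noteq> c" "{a, b, c} \<inter> w = {}"
    "\<And>x. x \<in> {a, b, c} \<Longrightarrow> (w \<union> {a, b, c} - {x}, w \<union> {a, b, c}) \<in> F"
    using assms by (auto simp: link_def full_sets_def)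
  have "w \<union> {a, b, c} - {c} = w \<union> {a, b}" "w \<union> {a, b, c} - {b} = w \<union> {a, c}"
    "w \<union> {a, b, c} - {a} = w \<union> {b, c}" using *(1-4) by auto
  then show "adj F (w \<union> {a, b}) (w \<union> {a, b, c})" "adj F (w \<union> {a, c}) (w \<union> {a, b, c})"
    "adj F (w \<union> {b, c}) (w \<union> {a, b, c})"
    using *(5)[of c] *(5)[of b] *(5)[of a] by (auto simp: adj_def)
qed

lemma link_distinct:
  assumes "(b, c) \<in> link F w a"
  shows "a \<noteq> b" "a \<noteq> c" "b \<noteq> c" "a \<notin> w" "b \<notin> w" "c \<notin> w"
  using assms by (auto simp: link_def full_sets_def)

lemma sym_link: "sym (link F w a)"
  by (auto simp: link_def sym_def insert_commute)

text \<open>One full triple seen from two of its elements; this is what lets cycles in different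
  links share an edge of \<open>F\<close>.\<close>

lemma link_rotate: "(b, c) \<in> link F w a \<Longrightarrow> (a, c) \<in> link F w b"
  by (auto simp: link_def insert_commute)

text \<open>\<open>L\<close> runs the long way round the 8-cycle over w + a, from w + ab to w + abc;
  \<open>Z\<close> continues over w + b from w + bc to w + bu, and \<open>e\<close> leads back to w
  + ab. The lengths 8, \<open>4 * m - 3\<close> and 1 add up to \<open>4 * m + 6\<close>. The sets
  of \<open>Z\<close> avoid \<open>a\<close>, all others contain it, so only \<open>e\<close> and
  \<open>L\<close> could collide.\<close>

lemma contains_cycle_of_linked_cycles:
  assumes bc: "(b, c) \<in> link F w a" and K: "in_K23 (link F w a) b c"
    and cyc: "on_cycle (link F w b) (2 * m) a c" and m: "2 \<le> m"
  shows "contains_cycle F (4 * m + 6)"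
proof -
  obtain zs where zs: "length zs = 2 * m" "distinct zs"
    "successively (\<lambda>x y. (x, y) \<in> link F w b) zs" "hd zs = c" "last zs = a"
    using cyc by (auto simp: on_cycle_def)
  define ps where "ps = butlast zs"
  have zs_eq: "zs = ps @ [a]" using zs(1,5) m by (cases zs rule: rev_cases) (auto simp: ps_def)
  have ps_len: "length ps = 2 * m - 1" using zs(1) by (simp add: ps_def)
  have ps_ne: "ps \<noteq> []" using ps_len m by auto
  define u where "u = last ps"
  have ps: "distinct ps" "a \<notin> set ps" "hd ps = c" "successively (\<lambda>x y. (x, y) \<in> link F w b) ps"
    "(u, a) \<in> link F w b"
    using zs(2-4) ps_ne by (auto simp: zs_eq successively_append_iff u_def)
  \<comment> \<open>By \<open>2 \<le> m\<close> the path \<open>ps\<close> has more than one vertex;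
    with \<open>u = c\<close> the set \<open>e\<close> would be w + abc, which is in
    \<open>L\<close>.\<close>
  have uc: "u \<noteq> c"
  proof -
    obtain p q qs where "ps = p # q # qs" using ps_len m by (cases ps; cases "tl ps") auto
    then show ?thesis using ps(1,3) by (auto simp: u_def split: if_splits)
  qed
  have ps_dis: "set ps \<inter> insert b w = {}"
  proof -
    have "v \<notin> insert b w" if v: "v \<in> set ps" for v
    proof -
      obtain i where i: "i < length ps" "v = ps ! i" using v by (auto simp: in_set_conv_nth)
      then have "(v, zs ! Suc i) \<in> link F w b"
        using zs(3) by (auto simp: successively_conv_nth zs_eq nth_append split: if_splits)
      then show ?thesis by (auto dest: link_distinct)
    qed
    then show ?thesis by blast
  qed
  obtain x y1 y2 where xy: "x \<noteq> b" "y1 \<noteq> y2" "y1 \<noteq> c" "y2 \<noteq> c" "(x, c) \<in> link F w a"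
    "\<And>y. y \<in> {y1, y2} \<Longrightarrow> (b, y) \<in> link F w a \<and> (x, y) \<in> link F w a"
    using K by (auto simp: in_K23_def)
  have "\<exists>y\<in>{y1, y2}. y \<noteq> u" using xy(2) by auto
  then obtain y where y: "y \<noteq> u" "y \<noteq> c" "(b, y) \<in> link F w a" "(x, y) \<in> link F w a"
    using xy by blast
  have d: "a \<noteq> b" "a \<noteq> c" "b \<noteq> c" "a \<noteq> y" "b \<noteq> y" "a \<noteq> x" "x \<noteq> y" "x \<noteq> c" "x \<noteq> b" "y \<noteq> c"
    "a \<notin> w" "b \<notin> w" "c \<notin> w" "x \<notin> w" "y \<notin> w" "u \<notin> w" "u \<noteq> a" "u \<noteq> b"
    using link_distinct[OF bc] link_distinct[OF y(3)] link_distinct[OF y(4)]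
      link_distinct[OF xy(5)] link_distinct[OF ps(5)] xy(1) y(2) by auto
  define L where "L = [w \<union> {a, b}, w \<union> {a, b, y}, w \<union> {a, y}, w \<union> {a, x, y}, w \<union> {a, x},
    w \<union> {a, x, c}, w \<union> {a, c}, w \<union> {a, b, c}]"
  define Z where "Z = zigzag (insert b w) ps"
  define e where "e = w \<union> {b, u, a}"
  define cs where "cs = L @ Z @ [e]"
  \<comment> \<open>The eight sets are told apart by which of four elements they contain.\<close>
  have "distinct (map (\<lambda>A. (b \<in> A, y \<in> A, x \<in> A, c \<in> A)) L)"
    unfolding L_def using d by simp
  then have "distinct L" by (simp add: distinct_map)
  moreover have "distinct Z" unfolding Z_def using ps(1) ps_dis by (rule distinct_zigzag)
  moreover have aZ: "a \<notin> A" if "A \<in> set Z" for A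
    using zigzag_subset[of A "insert b w" ps] that ps(2) d by (auto simp: Z_def)
  moreover have "a \<in> A" if "A \<in> set L" for A using that by (auto simp: L_def)
  moreover have "a \<in> e" by (simp add: e_def)
  \<comment> \<open>The sets of \<open>L\<close> that contain \<open>b\<close> are w + ab, w + aby
    and w + abc; none contains \<open>u\<close>, by the choice of \<open>y\<close> and by
    \<open>uc\<close>.\<close>
  moreover have "e \<notin> set L"
  proof
    assume "e \<in> set L"
    moreover have "b \<in> e" "u \<in> e" "y \<notin> e" "c \<notin> e" using d y uc by (auto simp: e_def)
    ultimately show False using d by (auto simp: L_def)
  qed
  ultimately have "distinct cs" by (auto simp: cs_def)
  moreover have "successively (adj F) cs"
  proof -
    have L: "successively (adj F) L"
      using link_adj[OF bc] link_adj[OF y(3)] link_adj[OF y(4)] link_adj[OF xy(5)]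
      by (simp add: L_def adj_def disj_commute)
    have Z: "successively (adj F) Z"
      unfolding Z_def
    proof (rule successively_zigzag[OF ps(4)])
      fix p q assume "(p, q) \<in> link F w b"
      from link_adj(1,2)[OF this]
      show "adj F (insert p (insert b w)) (insert p (insert q (insert b w))) \<and>
        adj F (insert p (insert q (insert b w))) (insert q (insert b w))"
        by (simp add: adj_def insert_commute disj_commute)
    qed
    have "last L = w \<union> {a, b, c}" by (simp add: L_def)
    moreover have "hd Z = w \<union> {b, c}" "last Z = w \<union> {b, u}"
      using ps_ne ps(3) by (auto simp: Z_def hd_zigzag last_zigzag u_def)
    moreover have "Z \<noteq> []" using ps_ne by (simp add: Z_def)
    ultimately show ?thesis unfolding cs_def successively_append_iff
      using L Z link_adj(3)[OF bc] link_adj(1)[OF ps(5)]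
      by (simp add: e_def adj_def disj_commute)
  qed
  moreover have "adj F (last cs) (hd cs)"
    using link_adj(2)[OF ps(5)] by (simp add: cs_def e_def L_def adj_def insert_commute disj_commute)
  moreover have "length cs = 4 * m + 6"
    using ps_len m by (simp add: cs_def L_def Z_def length_zigzag)
  moreover have "cs \<noteq> []" by (simp add: cs_def)
  ultimately show ?thesis using contains_cycleI[of cs F] by simp
qed

text \<open>Every ordered full triple fails one of two tests, for bc in the link of a or for ac in
  the link of b. Over all links the two kinds of failure contribute the constants 3 and
  \<open>40 * (2 * m + 3)\<close>, where \<open>m = l - 1\<close>; together they make
  \<open>80 * l + 43\<close>.\<close>

lemma full_triples_le:
  assumes F: "F \<subseteq> doubled_odd_edges k" and no: "\<not> contains_cycle F (4 * l + 2)" and l: "3 \<le> l"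
  shows "real (card (full_sets F 3 w)) \<le> (80 * real l + 43) * real (2 * k + 1) powr (5 / 2)"
proof -
  define m where "m = l - 1"
  have m: "2 \<le> m" "4 * m + 6 = 4 * l + 2" using l by (auto simp: m_def)
  define V where "V = {..<2 * k + 1}"
  define n where "n = real (card V)"
  have n: "1 \<le> n" "n = real (2 * k + 1)" by (auto simp: n_def V_def)
  have finV: "finite V" by (simp add: V_def)
  have mem: "a \<in> V \<and> b \<in> V \<and> c \<in> V" if "(b, c) \<in> link F w a" for a b c
    using finite_full_sets(2)[OF F, of 3 "{a, b, c}" w] that by (auto simp: link_def V_def)
  have linkV: "link F w a \<subseteq> V \<times> V" for a using mem by auto
  have irr: "irrefl (link F w a)" for a by (auto simp: irrefl_def link_def)
  define O3 where "O3 = {(a, b, c). (b, c) \<in> link F w a}"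
  define M1 where "M1 a = {(b, c) \<in> link F w a. \<not> in_K23 (link F w a) b c}" for a
  define M2 where "M2 b = {(a, c) \<in> link F w b. \<not> on_cycle (link F w b) (2 * m) a c}" for b
  have finM: "finite (M1 a)" "finite (M2 a)" for a
    using finite_subset[OF linkV] finV
    by (auto simp: M1_def M2_def intro: finite_subset[of _ "link F w a"])
  define B1 where "B1 = (SIGMA a:V. M1 a)"
  \<comment> \<open>\<open>M2\<close> is indexed by the middle entry of the triple, hence the
    reordering.\<close>
  define B2 where "B2 = (\<lambda>(b, a, c). (a, b, c)) ` (SIGMA b:V. M2 b)"
  have finB: "finite B1" "finite B2" using finM finV by (auto simp: B1_def B2_def)
  have O3: "O3 \<subseteq> B1 \<union> B2"
  proof
    fix t assume "t \<in> O3"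
    then obtain a b c where t: "t = (a, b, c)" "(b, c) \<in> link F w a" by (auto simp: O3_def)
    then have "\<not> in_K23 (link F w a) b c \<or> \<not> on_cycle (link F w b) (2 * m) a c"
      using contains_cycle_of_linked_cycles[OF t(2) _ _ m(1)] no unfolding m(2) by blast
    then have "(b, c) \<in> M1 a \<or> (a, c) \<in> M2 b"
      using t(2) link_rotate[OF t(2)] by (auto simp: M1_def M2_def)
    then show "t \<in> B1 \<union> B2" using mem[OF t(2)] t(1) by (force simp: B1_def B2_def)
  qed
  have "card (full_sets F 3 w) \<le> card O3"
  proof (rule surj_card_le)
    show "finite O3" using O3 finB by (meson finite_UnI finite_subset)
    show "full_sets F 3 w \<subseteq> (\<lambda>(a, b, c). {a, b, c}) ` O3"
    proof
      fix T assume T: "T \<in> full_sets F 3 w"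
      then obtain a b c where "T = {a, b, c}" "a \<noteq> b" "b \<noteq> c" "a \<noteq> c"
        by (auto simp: full_sets_def card_3_iff)
      then show "T \<in> (\<lambda>(a, b, c). {a, b, c}) ` O3"
        using T by (intro image_eqI[of _ _ "(a, b, c)"]) (auto simp: O3_def link_def)
    qed
  qed
  also have "card O3 \<le> card (B1 \<union> B2)" using O3 finB by (intro card_mono) auto
  also have "\<dots> \<le> card B1 + card B2" by (rule card_Un_le)
  also have "\<dots> \<le> (\<Sum>a\<in>V. card (M1 a)) + (\<Sum>b\<in>V. card (M2 b))"
  proof (rule add_mono)
    show "card B1 \<le> (\<Sum>a\<in>V. card (M1 a))" using finM finV by (simp add: B1_def)
    have "card B2 \<le> card (SIGMA b:V. M2 b)"
      unfolding B2_def using finM finV by (intro card_image_le) auto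
    then show "card B2 \<le> (\<Sum>b\<in>V. card (M2 b))" using finM finV by simp
  qed
  finally have "real (card (full_sets F 3 w)) \<le> (\<Sum>a\<in>V. real (card (M1 a))) + (\<Sum>b\<in>V. real (card (M2 b)))"
    by (metis of_nat_le_iff of_nat_add of_nat_sum)
  also have "\<dots> \<le> (\<Sum>a\<in>V. 3 * n powr (3 / 2)) + (\<Sum>b\<in>V. 40 * (2 * real m + 3) * n powr (3 / 2))"
  proof (intro add_mono sum_mono)
    fix a
    show "real (card (M1 a)) \<le> 3 * n powr (3 / 2)"
      unfolding M1_def n_def by (rule card_not_in_K23_le[OF finV linkV])
    have "real (card (M2 a)) \<le> 40 * (2 * real m + 3) * n powr (1 + 1 / real m)"
      unfolding M2_def n_def using card_not_on_cycle_le[OF finV linkV sym_link irr] m by simp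
    also have "\<dots> \<le> 40 * (2 * real m + 3) * n powr (3 / 2)"
      using n m by (intro mult_left_mono powr_mono) (auto simp: field_simps)
    finally show "real (card (M2 a)) \<le> 40 * (2 * real m + 3) * n powr (3 / 2)" .
  qed
  also have "\<dots> = (80 * real l + 43) * (n powr 1 * n powr (3 / 2))"
    using l n(1) by (simp add: m_def of_nat_diff algebra_simps flip: n_def)
  also have "n powr 1 * n powr (3 / 2) = n powr (5 / 2)"
    unfolding powr_add[symmetric] by simp
  finally show ?thesis using n(2) by simp
qed

text \<open>\<open>2 \<le> k\<close> ensures \<open>3 \<le> k + 1\<close>, as needed for counting
  triples inside top vertices. The exponent \<open>5 / 6\<close> of \<open>\<tau>\<close> is a third
  of the \<open>5 / 2\<close> for full triples.\<close>

lemma card_C4l2_free_le: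
  assumes l: "3 \<le> l"
  shows "\<exists>C\<ge>0. \<forall>k\<ge>2. \<forall>F\<subseteq>doubled_odd_edges k. \<not> contains_cycle F (4 * l + 2) \<longrightarrow>
    real (card F) \<le> C * (real k powr (- 1 / 6) * real (card (doubled_odd_edges k)))"
proof (intro exI conjI allI impI)
  define c where "c = (80 * real l + 43) * 27"
  show "0 \<le> 3 * (1 + c)" by (simp add: c_def)
  fix k F assume k: "2 \<le> k" and F: "F \<subseteq> doubled_odd_edges k" and no: "\<not> contains_cycle F (4 * l + 2)"
  define \<tau> where "\<tau> = real k powr (5 / 6)"
  have \<tau>1: "1 \<le> \<tau>" using k by (simp add: \<tau>_def ge_one_powr_ge_zero)
  have \<tau>3: "\<tau> ^ 3 = real k powr (5 / 2)"
    unfolding \<tau>_def power3_eq_cube powr_add[symmetric] by simp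
  have k1: "1 \<le> k" using k by simp
  have M: "real (card (full_sets F 3 w)) \<le> c * \<tau> ^ 3" for w
  proof -
    have "real (card (full_sets F 3 w)) \<le> (80 * real l + 43) * real (2 * k + 1) powr (5 / 2)"
      by (rule full_triples_le[OF F no l])
    also have "\<dots> \<le> (80 * real l + 43) * (27 * real k powr (5 / 2))"
      using k by (intro mult_left_mono card_odd_powr_le) auto
    also have "\<dots> = c * \<tau> ^ 3" unfolding c_def \<tau>3 by (rule mult.assoc[symmetric])
    finally show ?thesis .
  qed
  have "real (card F) \<le> real 3 * (1 + c) * (\<tau> / k * card (doubled_odd_edges k))"
    using k by (intro card_le_of_full_sets_le[OF F _ _ k1 \<tau>1 M]) auto
  also have "\<tau> / k = real k powr (- 1 / 6)"
  proof -
    have "\<tau> / k = real k powr (5 / 6) / real k powr 1"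
      using k by (simp add: \<tau>_def)
    also have "\<dots> = real k powr (5 / 6 - 1)" by (rule powr_diff[symmetric])
    finally show ?thesis by simp
  qed
  finally show "real (card F) \<le> 3 * (1 + c) *
      (real k powr (- 1 / 6) * real (card (doubled_odd_edges k)))" by simp
qed

section \<open>Cycles of length 6 and 10\<close>

text \<open>
  A tuple (w, a, b, c) stands for the hexagon on w + a, w + ab, w + b, w + bc, w + c, w + ca; each
  hexagon occurs six times.
\<close>

definition hexagons :: "nat \<Rightarrow> (nat set \<times> nat \<times> nat \<times> nat) set" where
  "hexagons k = {(w, a, b, c). w \<subseteq> {..<2 * k + 1} \<and> card w = k - 1 \<and>
     {a, b, c} \<subseteq> {..<2 * k + 1} - w \<and> a \<noteq> b \<and> a \<noteq> c \<and> b \<noteq> c}"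

text \<open>Not symmetric in \<open>a\<close> and \<open>b\<close>: the two orders give two
  different edges below w + ab, so the six ordered pairs from a, b, c give the six edges of the
  hexagon.\<close>

definition hex_edge :: "nat set \<Rightarrow> nat \<Rightarrow> nat \<Rightarrow> nat set \<times> nat set" where
  "hex_edge w a b = (insert a w, insert a (insert b w))"

lemma finite_hexagons: "finite (hexagons k)"
proof (rule finite_subset)
  let ?V = "{..<2 * k + 1}"
  show "hexagons k \<subseteq> Pow ?V \<times> ?V \<times> ?V \<times> ?V" by (auto simp: hexagons_def)
qed auto

text \<open>These two transpositions generate all orders of \<open>a\<close>, \<open>b\<close>,
  \<open>c\<close>.\<close>

lemma sum_hexagons_swap:
  "(\<Sum>(w, a, b, c)\<in>hexagons k. H w b a c) = (\<Sum>(w, a, b, c)\<in>hexagons k. H w a b c)"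
  "(\<Sum>(w, a, b, c)\<in>hexagons k. H w a c b) = (\<Sum>(w, a, b, c)\<in>hexagons k. H w a b c)"
  by (rule sum.reindex_bij_witness[where i = "\<lambda>(w, a, b, c). (w, b, a, c)"
        and j = "\<lambda>(w, a, b, c). (w, b, a, c)"]; force simp: hexagons_def)
     (rule sum.reindex_bij_witness[where i = "\<lambda>(w, a, b, c). (w, a, c, b)"
        and j = "\<lambda>(w, a, b, c). (w, a, c, b)"]; force simp: hexagons_def)

lemma hex_edge_in:
  assumes "(w, a, b, c) \<in> hexagons k" "1 \<le> k"
  shows "hex_edge w a b \<in> doubled_odd_edges k"
proof -
  have "finite w" using assms by (auto simp: hexagons_def intro: finite_subset)
  then show ?thesis using assms
    by (auto simp: hex_edge_def doubled_odd_edges_iff hexagons_def intro!: bexI[of _ b])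
qed

text \<open>An edge does not tell which element of its lower end plays the role of \<open>a\<close>;
  once \<open>a\<close> is recorded, \<open>w\<close> and \<open>b\<close> follow.\<close>

lemma inj_on_hexagons:
  "inj_on (\<lambda>(w, a, b, c). (hex_edge w a b, a, c)) (hexagons k)"
proof (rule inj_onI)
  fix s t assume st: "s \<in> hexagons k" "t \<in> hexagons k"
    "(\<lambda>(w, a, b, c). (hex_edge w a b, a, c)) s = (\<lambda>(w, a, b, c). (hex_edge w a b, a, c)) t"
  obtain w a b c where s: "s = (w, a, b, c)" by (cases s)
  obtain w' b' where t: "t = (w', a, b', c)" using st(3) s by (cases t) auto
  have h: "(w, a, b, c) \<in> hexagons k" "(w', a, b', c) \<in> hexagons k" using st s t by auto
  have e: "insert a w = insert a w'" "insert a (insert b w) = insert a (insert b' w')"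
    using st(3) s t by (auto simp: hex_edge_def)
  have d: "a \<notin> w" "a \<notin> w'" "b \<notin> insert a w" "b' \<notin> insert a w'" using h by (auto simp: hexagons_def)
  have "w = w'" using e(1) insert_ident[OF d(1,2)] by simp
  moreover have "b = b'" using e(2) d \<open>w = w'\<close> by auto
  ultimately show "s = t" using s t by simp
qed

text \<open>Uniformity of the cover: for a given edge, \<open>a\<close> is any of the
  \<open>k\<close> elements of the lower end and \<open>c\<close> any of the \<open>k\<close>
  elements outside the upper end.\<close>

lemma card_hexagons_edge_in:
  assumes F: "F \<subseteq> doubled_odd_edges k" and k: "1 \<le> k"
  shows "card {(w, a, b, c) \<in> hexagons k. hex_edge w a b \<in> F} = k * k * card F"
proof -
  let ?A = "{(w, a, b, c) \<in> hexagons k. hex_edge w a b \<in> F}"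
  let ?f = "\<lambda>(w, a, b, c). (hex_edge w a b, a, c)"
  define B where "B = (SIGMA e:F. fst e \<times> ({..<2 * k + 1} - snd e))"
  have finF: "finite F" using F finite_doubled_odd_edges finite_subset by blast
  have "?f ` ?A = B"
  proof (intro equalityI subsetI)
    fix t assume "t \<in> ?f ` ?A"
    then show "t \<in> B" by (auto simp: B_def hex_edge_def hexagons_def)
  next
    fix t assume "t \<in> B"
    then obtain u v a c where t: "t = ((u, v), a, c)" "(u, v) \<in> F" "a \<in> u" "c < 2 * k + 1" "c \<notin> v"
      by (auto simp: B_def)
    then obtain b where v: "v \<subseteq> {..<2 * k + 1}" "card v = k + 1" "b \<in> v" "u = v - {b}"
      using subsetD[OF F t(2)] doubled_odd_edges_iff[of u v k] by auto
    have fin: "finite v" using v(1) finite_subset by blast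
    have "card (u - {a}) = k - 1" using v t(3) fin by (simp add: card_Diff_singleton)
    then have "(u - {a}, a, b, c) \<in> hexagons k"
      using v t by (auto simp: hexagons_def)
    moreover have "hex_edge (u - {a}) a b = (u, v)" using v t by (auto simp: hex_edge_def)
    ultimately show "t \<in> ?f ` ?A" using t by (intro image_eqI[of _ _ "(u - {a}, a, b, c)"]) auto
  qed
  moreover have "inj_on ?f ?A" using inj_on_hexagons by (rule inj_on_subset) auto
  ultimately have "card ?A = card B" using card_image[of ?f ?A] by simp
  also have "\<dots> = (\<Sum>e\<in>F. card (fst e \<times> ({..<2 * k + 1} - snd e)))"
  proof -
    have "finite (fst e)" if "e \<in> F" for e
      using subsetD[OF F that] finite_subset[of "fst e" "{..<2 * k + 1}"]
      by (auto simp: doubled_odd_edges_def doubled_johnson_edges_def)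
    then show ?thesis unfolding B_def using finF by (intro card_SigmaI) auto
  qed
  also have "\<dots> = (\<Sum>e\<in>F. k * k)"
  proof (rule sum.cong[OF refl])
    fix e assume e: "e \<in> F"
    have "fst e \<subseteq> {..<2 * k + 1}" "card (fst e) = k" "snd e \<subseteq> {..<2 * k + 1}" "card (snd e) = k + 1"
      using subsetD[OF F e] by (auto simp: doubled_odd_edges_def doubled_johnson_edges_def)
    then show "card (fst e \<times> ({..<2 * k + 1} - snd e)) = k * k"
      by (simp add: card_cartesian_product card_Diff_subset finite_subset)
  qed
  finally show ?thesis by simp
qed

lemma sum_hexagons_edge:
  assumes F: "F \<subseteq> doubled_odd_edges k" and k: "1 \<le> k"
  shows "(\<Sum>(w, a, b, c)\<in>hexagons k. of_bool (hex_edge w a b \<in> F)) = k * k * card F"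
proof -
  have "(\<Sum>(w, a, b, c)\<in>hexagons k. of_bool (hex_edge w a b \<in> F)) =
     card (hexagons k \<inter> {(w, a, b, c). hex_edge w a b \<in> F})"
    by (simp add: case_prod_unfold of_bool_def sum.If_cases[OF finite_hexagons])
  also have "hexagons k \<inter> {(w, a, b, c). hex_edge w a b \<in> F} =
      {(w, a, b, c) \<in> hexagons k. hex_edge w a b \<in> F}" by auto
  finally show ?thesis using card_hexagons_edge_in[OF F k] by simp
qed

lemma card_hexagons:
  assumes "1 \<le> k"
  shows "card (hexagons k) = k * k * card (doubled_odd_edges k)"
proof -
  have "{(w, a, b, c) \<in> hexagons k. hex_edge w a b \<in> doubled_odd_edges k} = hexagons k"
    using hex_edge_in[OF _ assms] by auto
  then show ?thesis using card_hexagons_edge_in[OF subset_refl assms] by simp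
qed

section \<open>Averaging over hexagons\<close>

definition hex_count :: "(nat set \<times> nat set) set \<Rightarrow> nat set \<Rightarrow> nat \<Rightarrow> nat \<Rightarrow> nat \<Rightarrow> nat" where
  "hex_count F w a b c = of_bool (hex_edge w a b \<in> F) + of_bool (hex_edge w a c \<in> F) +
     of_bool (hex_edge w b a \<in> F) + of_bool (hex_edge w b c \<in> F) +
     of_bool (hex_edge w c a \<in> F) + of_bool (hex_edge w c b \<in> F)"

lemma sum_hexagons_perms:
  fixes H :: "nat set \<Rightarrow> nat \<Rightarrow> nat \<Rightarrow> nat \<Rightarrow> nat"
  shows "(\<Sum>(w, a, b, c)\<in>hexagons k. H w a b c + H w a c b + H w b a c + H w b c a + H w c a b + H w c b a)
    = 6 * (\<Sum>(w, a, b, c)\<in>hexagons k. H w a b c)"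
proof -
  let ?S = "\<lambda>H. \<Sum>(w, a, b, c)\<in>hexagons k. H w a b c"
  have 1: "?S (\<lambda>w a b c. H w a c b) = ?S H" by (rule sum_hexagons_swap(2))
  have 2: "?S (\<lambda>w a b c. H w b a c) = ?S H" by (rule sum_hexagons_swap(1))
  have 3: "?S (\<lambda>w a b c. H w b c a) = ?S H"
    using sum_hexagons_swap(1)[where H = "\<lambda>w a b c. H w a c b" and k = k] 1 by simp
  have 4: "?S (\<lambda>w a b c. H w c a b) = ?S H"
    using sum_hexagons_swap(2)[where H = "\<lambda>w a b c. H w b a c" and k = k] 2 by simp
  have 5: "?S (\<lambda>w a b c. H w c b a) = ?S H"
    using sum_hexagons_swap(2)[where H = "\<lambda>w a b c. H w b c a" and k = k] 3 by simp
  show ?thesis using 1 2 3 4 5 by (simp add: sum.distrib case_prod_unfold)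
qed

lemma sum_hex_count:
  assumes F: "F \<subseteq> doubled_odd_edges k" and k: "1 \<le> k"
  shows "(\<Sum>(w, a, b, c)\<in>hexagons k. hex_count F w a b c) = 6 * (k * k * card F)"
  unfolding hex_count_def
  using sum_hexagons_perms[of "\<lambda>w a b c. of_bool (hex_edge w a b \<in> F)" k] sum_hexagons_edge[OF F k]
  by simp

lemma card_C6_free_le:
  assumes F: "F \<subseteq> doubled_odd_edges k" and k: "1 \<le> k" and no: "\<not> contains_cycle F 6"
  shows "6 * card F \<le> 5 * card (doubled_odd_edges k)"
proof -
  have "hex_count F w a b c \<le> 5" if h: "(w, a, b, c) \<in> hexagons k" for w a b c
  proof (rule ccontr)
    assume "\<not> ?thesis"
    then have e: "hex_edge w a b \<in> F" "hex_edge w a c \<in> F" "hex_edge w b a \<in> F" "hex_edge w b c \<in> F"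
      "hex_edge w c a \<in> F" "hex_edge w c b \<in> F"
      by (auto simp: hex_count_def of_bool_def split: if_splits)
    have d: "a \<noteq> b" "a \<noteq> c" "b \<noteq> c" "a \<notin> w" "b \<notin> w" "c \<notin> w" using h by (auto simp: hexagons_def)
    define cs where "cs = [insert a w, insert a (insert b w), insert b w, insert b (insert c w),
      insert c w, insert c (insert a w)]"
    have "distinct (map (\<lambda>A. (a \<in> A, b \<in> A, c \<in> A)) cs)" unfolding cs_def using d by simp
    then have "distinct cs" by (simp add: distinct_map)
    moreover have "successively (adj F) cs" "adj F (last cs) (hd cs)"
      using e by (auto simp: cs_def adj_def hex_edge_def insert_commute)
    ultimately have "contains_cycle F (length cs)" by (intro contains_cycleI) (auto simp: cs_def)
    then show False using no by (simp add: cs_def numeral_eq_Suc)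
  qed
  then have "(\<Sum>(w, a, b, c)\<in>hexagons k. hex_count F w a b c) \<le> (\<Sum>(w, a, b, c)\<in>hexagons k. 5)"
    by (intro sum_mono) auto
  then have "(k * k) * (6 * card F) \<le> (k * k) * (5 * card (doubled_odd_edges k))"
    unfolding sum_hex_count[OF F k] using card_hexagons[OF k] by (simp add: case_prod_unfold algebra_simps)
  then show ?thesis using k by simp
qed

text \<open>Two cells in the same column but in different rows force every other cell into that
  column, because a third cell shares its row with at most one of them. So \<open>S\<close> lies in
  a single row or column.\<close>

lemma card_no_skew_cells_le:
  assumes "finite A" "finite B" "card A \<le> k" "card B \<le> k" "S \<subseteq> A \<times> B"
    and skew: "\<And>a b a' b'. (a, b) \<in> S \<Longrightarrow> (a', b') \<in> S \<Longrightarrow> a = a' \<or> b = b'"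
  shows "card S \<le> k"
proof (cases "S = {}")
  case False
  then obtain a b where ab: "(a, b) \<in> S" by auto
  show ?thesis
  proof (cases "\<forall>p\<in>S. fst p = a")
    case True
    then have "S \<subseteq> Pair a ` B" using assms(5) by force
    then have "card S \<le> card B" using assms(2) by (rule surj_card_le[rotated])
    then show ?thesis using assms(4) by simp
  next
    case False
    then obtain a' b' where a': "(a', b') \<in> S" "a' \<noteq> a" by auto
    then have "b' = b" using skew[OF ab a'(1)] by simp
    have "snd p = b" if "p \<in> S" for p
      using skew[OF ab, of "fst p" "snd p"] skew[OF a'(1), of "fst p" "snd p"] that a' \<open>b' = b\<close> by auto
    then have "S \<subseteq> (\<lambda>x. (x, b)) ` A" using assms(5) by force
    then have "card S \<le> card A" using assms(1) by (rule surj_card_le[rotated])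
    then show ?thesis using assms(3) by simp
  qed
qed simp

text \<open>The omitted edge, from w + a to w + ab, need not be in F.\<close>

definition hex_rest :: "(nat set \<times> nat set) set \<Rightarrow> nat set \<Rightarrow> nat \<Rightarrow> nat \<Rightarrow> nat \<Rightarrow> bool" where
  "hex_rest F w a b c \<longleftrightarrow> hex_edge w a c \<in> F \<and> hex_edge w b a \<in> F \<and> hex_edge w b c \<in> F \<and>
     hex_edge w c a \<in> F \<and> hex_edge w c b \<in> F"

text \<open>Both hexagons pass through the edge from \<open>u\<close> to \<open>insert b u\<close>,
  and the five remaining edges of each join its ends. The two paths have no inner vertex in common:
  \<open>a \<noteq> a'\<close> separates the sets over \<open>w\<close> from those over
  \<open>w'\<close>, and \<open>c \<noteq> c'\<close> separates the neighbours of
  \<open>u\<close>.\<close>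

lemma hex_rest_skew_cycle:
  assumes 1: "hex_rest F (u - {a}) a b c" and 2: "hex_rest F (u - {a'}) a' b c'"
    and d: "a \<in> u" "a' \<in> u" "a \<noteq> a'" "b \<notin> u" "c \<notin> u" "c' \<notin> u" "b \<noteq> c" "b \<noteq> c'" "c \<noteq> c'"
  shows "contains_cycle F 10"
proof -
  define w w' where "w = u - {a}" and "w' = u - {a'}"
  have u: "u = insert a w" "u = insert a' w'" using d by (auto simp: w_def w'_def)
  define cs where "cs = [u, insert c u, insert c w, insert b (insert c w), insert b w, insert b u,
    insert b w', insert b (insert c' w'), insert c' w', insert c' u]"
  have m: "a \<notin> w" "a' \<in> w" "a \<in> w'" "a' \<notin> w'" "b \<notin> w" "b \<notin> w'" "c \<notin> w" "c \<notin> w'" "c' \<notin> w" "c' \<notin> w'"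
    using d by (auto simp: w_def w'_def)
  have "distinct (map (\<lambda>A. (a \<in> A, a' \<in> A, b \<in> A, c \<in> A, c' \<in> A)) cs)"
    unfolding cs_def using d m by auto
  then have "distinct cs" by (simp add: distinct_map)
  moreover have "adj F u (insert c u)" "adj F (insert c u) (insert c w)"
      "adj F (insert c w) (insert b (insert c w))" "adj F (insert b (insert c w)) (insert b w)"
      "adj F (insert b w) (insert b u)"
    using 1 unfolding w_def[symmetric] hex_rest_def hex_edge_def adj_def
    by (auto simp: u(1) insert_commute)
  moreover have "adj F (insert c' u) u" "adj F (insert c' w') (insert c' u)"
      "adj F (insert b (insert c' w')) (insert c' w')" "adj F (insert b w') (insert b (insert c' w'))"
      "adj F (insert b u) (insert b w')"
    using 2 unfolding w'_def[symmetric] hex_rest_def hex_edge_def adj_def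
    by (auto simp: u(2) insert_commute)
  ultimately have "contains_cycle F (length cs)"
    by (intro contains_cycleI) (simp_all add: cs_def)
  then show ?thesis by (simp add: cs_def numeral_eq_Suc)
qed

text \<open>For a fixed edge the pairs \<open>(a, c)\<close> form a \<open>k\<close> by
  \<open>k\<close> grid, \<open>b\<close> being determined by the edge. Skew cells would give a
  10-cycle, so at most \<open>k\<close> of the cells survive, a fraction of 1 / k.\<close>

lemma card_hex_rest_le:
  assumes no: "\<not> contains_cycle F 10" and k: "1 \<le> k"
  shows "card {(w, a, b, c) \<in> hexagons k. hex_rest F w a b c} \<le> k * card (doubled_odd_edges k)"
proof -
  let ?E = "doubled_odd_edges k"
  let ?f = "\<lambda>(w, a, b, c). (hex_edge w a b, a, c)"
  let ?A = "{(w, a, b, c) \<in> hexagons k. hex_rest F w a b c}"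
  define S where "S e = {(a, c). a \<in> fst e \<and> c \<in> {..<2 * k + 1} - snd e \<and>
    (\<exists>b. snd e = insert b (fst e) \<and> b \<notin> fst e \<and> hex_rest F (fst e - {a}) a b c)}" for e
  have E: "finite (fst e)" "card (fst e) = k" "card ({..<2 * k + 1} - snd e) = k" if "e \<in> ?E" for e
  proof -
    have "fst e \<subseteq> {..<2 * k + 1}" "card (fst e) = k" "snd e \<subseteq> {..<2 * k + 1}" "card (snd e) = k + 1"
      using that by (auto simp: doubled_odd_edges_def doubled_johnson_edges_def)
    then show "finite (fst e)" "card (fst e) = k" "card ({..<2 * k + 1} - snd e) = k"
      by (auto simp: card_Diff_subset finite_subset)
  qed
  have sub: "S e \<subseteq> fst e \<times> ({..<2 * k + 1} - snd e)" for e by (auto simp: S_def)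
  have cS: "card (S e) \<le> k" if e: "e \<in> ?E" for e
  proof (rule card_no_skew_cells_le[OF _ _ _ _ sub])
    show "finite (fst e)" "card (fst e) \<le> k" "card ({..<2 * k + 1} - snd e) \<le> k" using E[OF e] by auto
    show "finite ({..<2 * k + 1} - snd e)" by simp
    fix a c a' c' assume m: "(a, c) \<in> S e" "(a', c') \<in> S e"
    then obtain b b' where b: "snd e = insert b (fst e)" "b \<notin> fst e" "hex_rest F (fst e - {a}) a b c"
      "snd e = insert b' (fst e)" "b' \<notin> fst e" "hex_rest F (fst e - {a'}) a' b' c'"
      by (auto simp: S_def)
    then have "b' = b" by auto
    have "a \<in> fst e" "a' \<in> fst e" "c \<notin> snd e" "c' \<notin> snd e" using m by (auto simp: S_def)
    then show "a = a' \<or> c = c'"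
      using hex_rest_skew_cycle[OF b(3) b(6)[unfolded \<open>b' = b\<close>]] b(1,2) no by auto
  qed
  have "?f ` ?A \<subseteq> (SIGMA e:?E. S e)"
  proof
    fix t assume "t \<in> ?f ` ?A"
    then obtain w a b c where t: "t = (hex_edge w a b, a, c)" "(w, a, b, c) \<in> hexagons k" "hex_rest F w a b c"
      by auto
    then have d: "a \<notin> w" "b \<notin> w" "c \<notin> w" "a \<noteq> b" "a \<noteq> c" "b \<noteq> c" "c < 2 * k + 1"
      by (auto simp: hexagons_def)
    then have "insert a w - {a} = w" by auto
    then have "(a, c) \<in> S (hex_edge w a b)"
      using d t(3) by (auto simp: S_def hex_edge_def insert_commute intro!: exI[of _ b])
    then show "t \<in> (SIGMA e:?E. S e)" using t hex_edge_in[OF t(2) k] by auto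
  qed
  moreover have "inj_on ?f ?A" using inj_on_hexagons by (rule inj_on_subset) auto
  moreover have fS: "finite (S e)" if "e \<in> ?E" for e
    using sub by (rule finite_subset) (use E(1)[OF that] in auto)
  moreover have "finite (SIGMA e:?E. S e)" using fS finite_doubled_odd_edges by blast
  ultimately have "card ?A \<le> card (SIGMA e:?E. S e)" by (intro card_inj_on_le)
  also have "\<dots> = (\<Sum>e\<in>?E. card (S e))" using fS finite_doubled_odd_edges by simp
  also have "\<dots> \<le> (\<Sum>e\<in>?E. k)" by (intro sum_mono cS)
  finally show ?thesis by (simp add: mult.commute)
qed

text \<open>After summation \<open>6 * k * k * card F\<close> is at most
  \<open>4 * k * k + 12 * k\<close> times the number of edges; this is the origin of
  \<open>2 / 3\<close> and \<open>2 / k\<close>.\<close>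

lemma card_C10_free_le:
  assumes F: "F \<subseteq> doubled_odd_edges k" and k: "1 \<le> k" and no: "\<not> contains_cycle F 10"
  shows "real (card F) \<le> (2 / 3 + 2 / k) * card (doubled_odd_edges k)"
proof -
  define H where "H w a b c = (of_bool (hex_rest F w a b c) :: nat)" for w a b c
  have sumH: "(\<Sum>(w, a, b, c)\<in>hexagons k. H w a b c) \<le> k * card (doubled_odd_edges k)"
  proof -
    have "(\<Sum>(w, a, b, c)\<in>hexagons k. H w a b c) =
       card (hexagons k \<inter> {(w, a, b, c). hex_rest F w a b c})"
      by (simp add: case_prod_unfold of_bool_def sum.If_cases[OF finite_hexagons] H_def)
    also have "hexagons k \<inter> {(w, a, b, c). hex_rest F w a b c} =
        {(w, a, b, c) \<in> hexagons k. hex_rest F w a b c}" by auto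
    finally show ?thesis using card_hex_rest_le[OF no k] by simp
  qed
  \<comment> \<open>If at least five edges are present, some order of a, b, c makes the possibly
    missing one the edge ignored by \<open>hex_rest\<close>; five or six exceed 4 by at most
    2.\<close>
  have pt: "hex_count F w a b c \<le>
      4 + 2 * (H w a b c + H w a c b + H w b a c + H w b c a + H w c a b + H w c b a)" for w a b c
    unfolding hex_count_def H_def hex_rest_def by (auto simp: of_bool_def)
  have "(\<Sum>(w, a, b, c)\<in>hexagons k. hex_count F w a b c) \<le> (\<Sum>(w, a, b, c)\<in>hexagons k.
      4 + 2 * (H w a b c + H w a c b + H w b a c + H w b c a + H w c a b + H w c b a))"
    using pt by (intro sum_mono) auto
  also have "\<dots> = 4 * card (hexagons k) + 2 * (\<Sum>(w, a, b, c)\<in>hexagons k.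
      H w a b c + H w a c b + H w b a c + H w b c a + H w c a b + H w c b a)"
    by (simp add: case_prod_unfold sum.distrib sum_distrib_left)
  also have "\<dots> \<le> 4 * (k * k * card (doubled_odd_edges k)) + 12 * (k * card (doubled_odd_edges k))"
    unfolding sum_hexagons_perms using sumH by (simp add: card_hexagons[OF k])
  finally have "k * (6 * (k * card F)) \<le> k * (4 * (k * card (doubled_odd_edges k)) + 12 * card (doubled_odd_edges k))"
    unfolding sum_hex_count[OF F k] by (simp add: algebra_simps)
  then have "6 * (k * card F) \<le> 4 * (k * card (doubled_odd_edges k)) + 12 * card (doubled_odd_edges k)"
    using k by simp
  then have "real (6 * (k * card F)) \<le> real (4 * (k * card (doubled_odd_edges k)) + 12 * card (doubled_odd_edges k))"
    by (rule of_nat_mono)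
  then show ?thesis using k by (simp add: field_simps)
qed

section \<open>Extremal numbers\<close>

text \<open>\<open>k0\<close> absorbs small cases, and \<open>p \<le> q\<close> turns a stronger
  exponent into the claimed one.\<close>

lemma ex_cycle_bigo:
  assumes C: "0 \<le> C" "\<And>k F. k0 \<le> k \<Longrightarrow> F \<subseteq> doubled_odd_edges k \<Longrightarrow> \<not> contains_cycle F m \<Longrightarrow>
      real (card F) \<le> C * (real k powr p * real (card (doubled_odd_edges k)))"
    and m: "1 \<le> m" and pq: "p \<le> q"
  shows "(\<lambda>k. real (ex_cycle (doubled_odd_edges k) m))
      \<in> O(\<lambda>k. real k powr q * real (card (doubled_odd_edges k)))"
proof (rule bigoI[of _ C], rule eventually_sequentiallyI[of "max 1 k0"])
  fix k assume k: "max 1 k0 \<le> k"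
  have "real (ex_cycle (doubled_odd_edges k) m) \<le> C * (real k powr p * real (card (doubled_odd_edges k)))"
    using k by (intro ex_cycle_le[OF m] C(2)) auto
  also have "\<dots> \<le> C * (real k powr q * real (card (doubled_odd_edges k)))"
    using k pq C(1) by (intro mult_left_mono mult_right_mono powr_mono) auto
  finally show "norm (real (ex_cycle (doubled_odd_edges k) m))
      \<le> C * norm (real k powr q * real (card (doubled_odd_edges k)))" by simp
qed

lemma ex_C4l_bigo:
  assumes "3 \<le> l"
  shows "(\<lambda>k. real (ex_cycle (doubled_odd_edges k) (4 * l)))
      \<in> O(\<lambda>k. real k powr (- 1 / 2 + 1 / real l) * real (card (doubled_odd_edges k)))"
proof -
  obtain C where C: "0 \<le> C" "\<forall>k\<ge>1. \<forall>F\<subseteq>doubled_odd_edges k. \<not> contains_cycle F (4 * l) \<longrightarrow>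
    real (card F) \<le> C * (real k powr (- 1 / 2 + 1 / (2 * real l)) * real (card (doubled_odd_edges k)))"
    using card_C4l_free_le[of l] assms by auto
  show ?thesis
    by (rule ex_cycle_bigo[of C 1 _ "- 1 / 2 + 1 / (2 * real l)"])
      (use C assms in \<open>auto simp: field_simps\<close>)
qed

lemma ex_C4l2_bigo:
  assumes "3 \<le> l" "- 1 / 6 \<le> q"
  shows "(\<lambda>k. real (ex_cycle (doubled_odd_edges k) (4 * l + 2)))
      \<in> O(\<lambda>k. real k powr q * real (card (doubled_odd_edges k)))"
proof -
  obtain C where C: "0 \<le> C" "\<forall>k\<ge>2. \<forall>F\<subseteq>doubled_odd_edges k. \<not> contains_cycle F (4 * l + 2) \<longrightarrow>
    real (card F) \<le> C * (real k powr (- 1 / 6) * real (card (doubled_odd_edges k)))"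
    using card_C4l2_free_le[of l] assms by auto
  show ?thesis
    by (rule ex_cycle_bigo[of C 2 _ "- 1 / 6"]) (use C assms in auto)
qed

lemma ex_C8_le:
  assumes "0 < \<epsilon>"
  shows "eventually (\<lambda>k. real (ex_cycle (doubled_odd_edges k) 8)
    \<le> (2 / 3 + \<epsilon>) * real (card (doubled_odd_edges k))) at_top"
proof -
  obtain C where C: "0 \<le> C" "\<And>k F. 1 \<le> k \<Longrightarrow> F \<subseteq> doubled_odd_edges k \<Longrightarrow> \<not> contains_cycle F 8 \<Longrightarrow>
    real (card F) \<le> C * (real k powr (- 1 / 4) * real (card (doubled_odd_edges k)))"
    using card_C4l_free_le[of 2] by auto
  have "((\<lambda>k. C * real k powr (- 1 / 4)) \<longlongrightarrow> C * 0) at_top"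
    by (intro tendsto_mult tendsto_const tendsto_neg_powr filterlim_real_sequentially) auto
  then have "eventually (\<lambda>k. C * real k powr (- 1 / 4) < 2 / 3 + \<epsilon>) at_top"
    using assms by (intro order_tendstoD(2)[of _ "C * 0"]) auto
  then show ?thesis using eventually_ge_at_top[of 1]
  proof eventually_elim
    case (elim k)
    have "real (ex_cycle (doubled_odd_edges k) 8)
        \<le> C * (real k powr (- 1 / 4) * real (card (doubled_odd_edges k)))"
      using elim by (intro ex_cycle_le C(2)) auto
    also have "\<dots> = (C * real k powr (- 1 / 4)) * real (card (doubled_odd_edges k))" by simp
    also have "\<dots> \<le> (2 / 3 + \<epsilon>) * real (card (doubled_odd_edges k))"
      using elim by (intro mult_right_mono) auto
    finally show ?case .
  qed
qed

lemma ex_C10_le: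
  assumes "0 < \<epsilon>"
  shows "eventually (\<lambda>k. real (ex_cycle (doubled_odd_edges k) 10)
    \<le> (2 / 3 + \<epsilon>) * real (card (doubled_odd_edges k))) at_top"
proof -
  have "((\<lambda>k. 2 / real k) \<longlongrightarrow> 0) at_top"
    by (intro tendsto_divide_0[OF tendsto_const] filterlim_at_top_imp_at_infinity
        filterlim_real_sequentially)
  then have "eventually (\<lambda>k. 2 / real k < \<epsilon>) at_top"
    using assms by (intro order_tendstoD(2)[of _ 0]) auto
  then show ?thesis using eventually_ge_at_top[of 1]
  proof eventually_elim
    case (elim k)
    have "real (ex_cycle (doubled_odd_edges k) 10) \<le> (2 / 3 + 2 / k) * card (doubled_odd_edges k)"
      using elim by (intro ex_cycle_le card_C10_free_le) auto
    also have "\<dots> \<le> (2 / 3 + \<epsilon>) * real (card (doubled_odd_edges k))"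
      using elim by (intro mult_right_mono) auto
    finally show ?case .
  qed
qed

lemma ex_C6_le:
  assumes "1 \<le> k"
  shows "real (ex_cycle (doubled_odd_edges k) 6) \<le> 5 / 6 * real (card (doubled_odd_edges k))"
proof (rule ex_cycle_le)
  fix F assume "F \<subseteq> doubled_odd_edges k" "\<not> contains_cycle F 6"
  then have "6 * card F \<le> 5 * card (doubled_odd_edges k)" using card_C6_free_le assms by blast
  then show "real (card F) \<le> 5 / 6 * real (card (doubled_odd_edges k))" by linarith
qed simp

theorem theorem1p2:
  shows
  "(\<forall>l::nat. l \<ge> 3 \<longrightarrow>
      (\<lambda>k. real (ex_cycle (doubled_odd_edges k) (4 * l)))
        \<in> O(\<lambda>k. real k powr (- 1 / 2 + 1 / real l) * real (card (doubled_odd_edges k))))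
   \<and> (\<forall>l::nat. l \<ge> 3 \<longrightarrow> l \<in> {3, 5, 7, 9} \<longrightarrow>
      (\<lambda>k. real (ex_cycle (doubled_odd_edges k) (4 * l + 2)))
        \<in> O(\<lambda>k. real k powr (- 1 / (2 * real l + 1)) * real (card (doubled_odd_edges k))))
   \<and> (\<forall>l::nat. l \<ge> 3 \<longrightarrow> l \<notin> {3, 5, 7, 9} \<longrightarrow>
      (\<lambda>k. real (ex_cycle (doubled_odd_edges k) (4 * l + 2)))
        \<in> O(\<lambda>k. real k powr (- 1 / 16 + 1 / (8 * (real l - 1))) * real (card (doubled_odd_edges k))))
   \<and> (\<forall>k::nat. k \<ge> 1 \<longrightarrow>
      real (ex_cycle (doubled_odd_edges k) 6) \<le> 5 / 6 * real (card (doubled_odd_edges k)))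
   \<and> (\<forall>\<epsilon>>0. eventually (\<lambda>k. real (ex_cycle (doubled_odd_edges k) 8)
          \<le> (2 / 3 + \<epsilon>) * real (card (doubled_odd_edges k))) at_top)
   \<and> (\<forall>\<epsilon>>0. eventually (\<lambda>k. real (ex_cycle (doubled_odd_edges k) 10)
          \<le> (2 / 3 + \<epsilon>) * real (card (doubled_odd_edges k))) at_top)"
proof (intro conjI allI impI)
  fix l :: nat assume l: "3 \<le> l"
  show "(\<lambda>k. real (ex_cycle (doubled_odd_edges k) (4 * l)))
      \<in> O(\<lambda>k. real k powr (- 1 / 2 + 1 / real l) * real (card (doubled_odd_edges k)))"
    using l by (rule ex_C4l_bigo)
  \<comment> \<open>This amounts to \<open>6 \<le> 2 * l + 1\<close>, which holds from
    \<open>l = 3\<close> on.\<close>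
  have "- 1 / 6 \<le> - 1 / (2 * real l + 1)" using l by (simp add: field_simps)
  then show "(\<lambda>k. real (ex_cycle (doubled_odd_edges k) (4 * l + 2)))
      \<in> O(\<lambda>k. real k powr (- 1 / (2 * real l + 1)) * real (card (doubled_odd_edges k)))"
    by (rule ex_C4l2_bigo[OF l])
  have "0 \<le> 1 / (8 * (real l - 1))" using l by simp
  then have "- 1 / 6 \<le> - 1 / 16 + 1 / (8 * (real l - 1))" by linarith
  then show "(\<lambda>k. real (ex_cycle (doubled_odd_edges k) (4 * l + 2)))
      \<in> O(\<lambda>k. real k powr (- 1 / 16 + 1 / (8 * (real l - 1))) * real (card (doubled_odd_edges k)))"
    by (rule ex_C4l2_bigo[OF l])
qed (fact ex_C6_le ex_C8_le ex_C10_le)+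

end
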